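(* Let $H$ be a compact Abelian group and $PH$ the $P$-modification of $H$. Then the group $PH$ is reflexive.
   Context: Topological groups are assumed Hausdorff. For a topological group $H$, $PH$ ($P$-modification) is the same group with the finer group topology whose base consists of all $G_\delta$-sets of $H$. $\mathbb T=\{z\in\mathbb C:|z|=1\}$ is the circle group. For a topological Abelian group $G$, $G^\wedge$ is the group of continuous characters (continuous homomorphisms $G\to\mathbb T$) with the topology of uniform convergence on compact subsets of $G$. $G$ is reflexive if the evaluation homomorphism $\alpha_G:G\to G^{\wedge\wedge}$, $\alpha_G(x)(\chi)=\chi(x)$, is a topological isomorphism of $G$ onto $G^{\wedge\wedge}=(G^\wedge)^\wedge$. *)

theory Defs
  imports "HOL-Analysis.Analysis" "HOL-Algebra.Group"
begin

locale topological_abelian_group = comm_group G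
  for G :: "('a, 'b) monoid_scheme" (structure) and T :: "'a topology" +
  assumes topspace_eq_carrier: "topspace T = carrier G"
    and Hausdorff: "Hausdorff_space T"
    and continuous_mult: "continuous_map (prod_topology T T) T (\<lambda>(x, y). x \<otimes> y)"
    and continuous_inv: "continuous_map T T (\<lambda>x. inv x)"

definition P_modification :: "'a topology \<Rightarrow> 'a topology" where
  "P_modification T = topology (arbitrary union_of gdelta_in T)"

lemma openin_P_modification:
  "openin (P_modification T) = arbitrary union_of gdelta_in T"
  unfolding P_modification_def
  by (rule topology_inverse') (simp add: istopology_base gdelta_in_Int)

lemma topspace_P_modification [simp]: "topspace (P_modification T) = topspace T"
proof
  show "topspace (P_modification T) \<subseteq> topspace T"
    unfolding topspace_def[of "P_modification T"] openin_P_modification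
    by (auto simp: union_of_def dest!: gdelta_in_subset)
  have "openin (P_modification T) (topspace T)"
    unfolding openin_P_modification arbitrary_def by (rule union_of_inc) auto
  then show "topspace T \<subseteq> topspace (P_modification T)"
    by (rule openin_subset)
qed

definition circle_group :: "complex monoid" where
  "circle_group = \<lparr>carrier = sphere 0 1, mult = (*), one = 1\<rparr>"

definition circle_topology :: "complex topology" where
  "circle_topology = top_of_set (sphere 0 1)"

text \<open>Characters are normalised to \<open>undefined\<close> outside the carrier of \<open>G\<close>, so that
  equality of characters is equality of functions on \<open>G\<close>.\<close>

definition continuous_characters ::
    "('a, 'b) monoid_scheme \<Rightarrow> 'a topology \<Rightarrow> ('a \<Rightarrow> complex) set" where
  "continuous_characters G T =
     {\<phi> \<in> hom G circle_group. continuous_map T circle_topology \<phi> \<and> \<phi> \<in> extensional (carrier G)}"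

definition dual_group :: "('a, 'b) monoid_scheme \<Rightarrow> 'a topology \<Rightarrow> ('a \<Rightarrow> complex) monoid" where
  "dual_group G T =
     \<lparr>carrier = continuous_characters G T,
      mult = (\<lambda>\<phi> \<psi>. \<lambda>x\<in>carrier G. \<phi> x * \<psi> x),
      one = (\<lambda>x\<in>carrier G. 1)\<rparr>"

text \<open>The sets of all \<open>\<psi>\<close> that are uniformly \<open>\<epsilon>\<close>-close to \<open>\<phi>\<close> on a compact set \<open>K\<close>
  form a neighbourhood base at \<open>\<phi>\<close>.\<close>

definition dual_open ::
    "('a, 'b) monoid_scheme \<Rightarrow> 'a topology \<Rightarrow> ('a \<Rightarrow> complex) set \<Rightarrow> bool" where
  "dual_open G T U \<longleftrightarrow>
     U \<subseteq> continuous_characters G T \<and>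
     (\<forall>\<phi>\<in>U. \<exists>K \<epsilon>. compactin T K \<and> \<epsilon> > 0 \<and>
        {\<psi> \<in> continuous_characters G T. \<forall>x\<in>K. dist (\<psi> x) (\<phi> x) < \<epsilon>} \<subseteq> U)"

definition dual_topology ::
    "('a, 'b) monoid_scheme \<Rightarrow> 'a topology \<Rightarrow> ('a \<Rightarrow> complex) topology" where
  "dual_topology G T = topology (dual_open G T)"

lemma istopology_dual_open: "istopology (dual_open G T)"
  unfolding istopology_def
proof (intro conjI allI impI)
  fix U V assume U: "dual_open G T U" and V: "dual_open G T V"
  show "dual_open G T (U \<inter> V)"
    unfolding dual_open_def
  proof (intro conjI ballI)
    show "U \<inter> V \<subseteq> continuous_characters G T" using U by (auto simp: dual_open_def)
    fix \<phi> assume "\<phi> \<in> U \<inter> V"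
    then obtain K \<epsilon> L \<delta> where K: "compactin T K" "\<epsilon> > 0"
        "{\<psi> \<in> continuous_characters G T. \<forall>x\<in>K. dist (\<psi> x) (\<phi> x) < \<epsilon>} \<subseteq> U"
      and L: "compactin T L" "\<delta> > 0"
        "{\<psi> \<in> continuous_characters G T. \<forall>x\<in>L. dist (\<psi> x) (\<phi> x) < \<delta>} \<subseteq> V"
      using U V unfolding dual_open_def by (meson IntE)
    have "{\<psi> \<in> continuous_characters G T. \<forall>x\<in>K \<union> L. dist (\<psi> x) (\<phi> x) < min \<epsilon> \<delta>} \<subseteq> U \<inter> V"
      using K(3) L(3) by auto
    moreover have "compactin T (K \<union> L)" "min \<epsilon> \<delta> > 0"
      using K L by (auto intro: compactin_Un)
    ultimately show "\<exists>K \<epsilon>. compactin T K \<and> \<epsilon> > 0 \<and>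
        {\<psi> \<in> continuous_characters G T. \<forall>x\<in>K. dist (\<psi> x) (\<phi> x) < \<epsilon>} \<subseteq> U \<inter> V"
      by blast
  qed
next
  fix \<U> assume \<U>: "\<forall>U\<in>\<U>. dual_open G T U"
  show "dual_open G T (\<Union>\<U>)"
    unfolding dual_open_def
  proof (intro conjI ballI)
    show "\<Union>\<U> \<subseteq> continuous_characters G T" using \<U> by (auto simp: dual_open_def)
    fix \<phi> assume "\<phi> \<in> \<Union>\<U>"
    then obtain U where U: "U \<in> \<U>" "\<phi> \<in> U" by blast
    then obtain K \<epsilon> where "compactin T K" "\<epsilon> > 0"
        "{\<psi> \<in> continuous_characters G T. \<forall>x\<in>K. dist (\<psi> x) (\<phi> x) < \<epsilon>} \<subseteq> U"
      using \<U> unfolding dual_open_def by meson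
    moreover have "U \<subseteq> \<Union>\<U>" using U(1) by (rule Union_upper)
    ultimately show "\<exists>K \<epsilon>. compactin T K \<and> \<epsilon> > 0 \<and>
        {\<psi> \<in> continuous_characters G T. \<forall>x\<in>K. dist (\<psi> x) (\<phi> x) < \<epsilon>} \<subseteq> \<Union>\<U>"
      by (meson subset_trans)
  qed
qed

lemma openin_dual_topology: "openin (dual_topology G T) = dual_open G T"
  unfolding dual_topology_def by (rule topology_inverse'[OF istopology_dual_open])

lemma topspace_dual_topology [simp]:
  "topspace (dual_topology G T) = continuous_characters G T"
proof
  show "topspace (dual_topology G T) \<subseteq> continuous_characters G T"
    unfolding topspace_def openin_dual_topology dual_open_def by blast
  have "dual_open G T (continuous_characters G T)"
    unfolding dual_open_def
    by (auto intro!: exI[of _ "{}"] exI[of _ "1::real"])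
  then show "continuous_characters G T \<subseteq> topspace (dual_topology G T)"
    unfolding openin_dual_topology[symmetric] by (rule openin_subset)
qed

abbreviation bidual_group ::
    "('a, 'b) monoid_scheme \<Rightarrow> 'a topology \<Rightarrow> (('a \<Rightarrow> complex) \<Rightarrow> complex) monoid" where
  "bidual_group G T \<equiv> dual_group (dual_group G T) (dual_topology G T)"

abbreviation bidual_topology ::
    "('a, 'b) monoid_scheme \<Rightarrow> 'a topology \<Rightarrow> (('a \<Rightarrow> complex) \<Rightarrow> complex) topology" where
  "bidual_topology G T \<equiv> dual_topology (dual_group G T) (dual_topology G T)"

definition evaluation_map ::
    "('a, 'b) monoid_scheme \<Rightarrow> 'a topology \<Rightarrow> 'a \<Rightarrow> ('a \<Rightarrow> complex) \<Rightarrow> complex" where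
  "evaluation_map G T = (\<lambda>x\<in>carrier G. \<lambda>\<phi>\<in>carrier (dual_group G T). \<phi> x)"

definition reflexive_group :: "('a, 'b) monoid_scheme \<Rightarrow> 'a topology \<Rightarrow> bool" where
  "reflexive_group G T \<longleftrightarrow>
     topological_abelian_group G T \<and>
     evaluation_map G T \<in> iso G (bidual_group G T) \<and>
     homeomorphic_map T (bidual_topology G T) (evaluation_map G T)"

end

theory Submission
  imports Defs "HOL-Library.Countable_Set_Type"
begin

text \<open>
  The topology of \<open>PH\<close> has a base at the identity formed by closed \<open>G\<^sub>\<delta>\<close> subgroups \<open>N\<close>, so its
  characters are the arbitrary homomorphisms to the circle that are trivial on some such \<open>N\<close>;
  compact subsets of \<open>PH\<close> are finite, so the dual carries the topology of pointwise convergence.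
  A continuous character of a group of characters with that topology is an evaluation: it factors
  through countably many coordinates, extends to a compact subset of a countable product of
  circles, is approximated there by trigonometric sums (Stone--Weierstrass), and a character at
  distance less than \<open>1\<close> from such a sum occurs in it.
  Divisibility of the circle lets characters separate points from subgroups, so that the
  annihilator of \<open>N\<close>, which is compact, recovers \<open>N\<close>; hence the evaluation map is injective and open.
  It is continuous because the characters in a compact subset of the dual are all trivial on
  one \<open>N\<close>; this is where compactness of \<open>H\<close> enters.
\<close>

section \<open>The P-modification of a topology\<close>

text \<open>A homeomorphism onto the bidual puts opposite demands on the compact subsets of the
  dual: there must be enough of them for openness and not too many for continuity. The annihilators
  are enough. The obstacle is the other bound: each character in a compact set \<open>K\<close> is
  trivial on a subgroup of its own, and an intersection of uncountably many such subgroups need not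
  be open in \<open>PH\<close>. This forces a recursion along the first uncountable ordinal: each
  stage intersects only countably many subgroups, so the recursion never stops, while the whole run
  is long enough to contradict compactness of \<open>K\<close>. Neither duality for \<open>H\<close>
  nor Haar measure enters. Characters of \<open>PH\<close> may be discontinuous on \<open>H\<close>,
  so they are built algebraically; and averages over the powers of one element do the work of
  orthogonality of characters in the completion of the dual. The radius 1 in the openness argument
  reflects that a subgroup of the circle contained in the open disc of radius 1 about 1 is
  trivial.\<close>

lemma openin_P_modification_iff:
  "openin (P_modification T) U \<longleftrightarrow>
    (\<forall>x\<in>U. \<exists>C::nat \<Rightarrow> 'a set. (\<forall>n. openin T (C n)) \<and> x \<in> (\<Inter>n. C n) \<and> (\<Inter>n. C n) \<subseteq> U)"
  unfolding openin_P_modification arbitrary_union_of_alt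
proof (intro ball_cong refl iffI)
  fix x assume "\<exists>S. gdelta_in T S \<and> x \<in> S \<and> S \<subseteq> U"
  then show "\<exists>C::nat \<Rightarrow> 'a set. (\<forall>n. openin T (C n)) \<and> x \<in> (\<Inter>n. C n) \<and> (\<Inter>n. C n) \<subseteq> U"
    unfolding gdelta_in_descending by metis
next
  fix x assume "\<exists>C::nat \<Rightarrow> 'a set. (\<forall>n. openin T (C n)) \<and> x \<in> (\<Inter>n. C n) \<and> (\<Inter>n. C n) \<subseteq> U"
  then obtain C :: "nat \<Rightarrow> 'a set"
    where C: "\<And>n. openin T (C n)" "x \<in> (\<Inter>n. C n)" "(\<Inter>n. C n) \<subseteq> U" by metis
  have "gdelta_in T (\<Inter>n. C n)"
    using C(1) by (intro gdelta_in_Inter) (auto intro: open_imp_gdelta_in)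
  then show "\<exists>S. gdelta_in T S \<and> x \<in> S \<and> S \<subseteq> U" using C(2,3) by blast
qed

lemma openin_P_modificationE:
  assumes "openin (P_modification T) U" "x \<in> U"
  obtains C :: "nat \<Rightarrow> 'a set"
    where "\<And>n. openin T (C n)" "x \<in> (\<Inter>n. C n)" "(\<Inter>n. C n) \<subseteq> U"
proof -
  have "\<exists>C::nat \<Rightarrow> 'a set. (\<forall>n. openin T (C n)) \<and> x \<in> (\<Inter>n. C n) \<and> (\<Inter>n. C n) \<subseteq> U"
    using assms unfolding openin_P_modification_iff by simp
  then show thesis using that by metis
qed

lemma openin_imp_openin_P_modification: "openin T U \<Longrightarrow> openin (P_modification T) U"
  unfolding openin_P_modification_iff by (auto intro!: exI[of _ "\<lambda>_. U"])

text \<open>The countably many sequences of open sets around a point are merged into one sequence by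
  the pairing bijection of the natural numbers. Thus a P-modification is a P-space: its own
  G_delta-sets are open.\<close>

lemma openin_P_modification_INT_nat:
  fixes U :: "nat \<Rightarrow> 'a set"
  assumes "\<And>n. openin (P_modification T) (U n)"
  shows "openin (P_modification T) (\<Inter>n. U n)"
  unfolding openin_P_modification_iff
proof
  fix x assume x: "x \<in> (\<Inter>n. U n)"
  have "\<forall>n. \<exists>C::nat \<Rightarrow> 'a set. (\<forall>k. openin T (C k)) \<and> x \<in> (\<Inter>k. C k) \<and> (\<Inter>k. C k) \<subseteq> U n"
    using assms x unfolding openin_P_modification_iff by simp
  then obtain C :: "nat \<Rightarrow> nat \<Rightarrow> 'a set" where C: "\<And>n k. openin T (C n k)"
     "\<And>n. x \<in> (\<Inter>k. C n k)" "\<And>n. (\<Inter>k. C n k) \<subseteq> U n"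
    by metis
  have "(\<Inter>m. case_prod C (prod_decode m)) \<subseteq> C n k" for n k
    by (metis INT_lower UNIV_I case_prod_conv prod_encode_inverse)
  then have "(\<Inter>m. case_prod C (prod_decode m)) \<subseteq> (\<Inter>n. U n)"
    by (intro INT_greatest order.trans[OF _ C(3)])
  then show "\<exists>C::nat \<Rightarrow> 'a set. (\<forall>n. openin T (C n)) \<and> x \<in> (\<Inter>n. C n) \<and> (\<Inter>n. C n) \<subseteq> (\<Inter>n. U n)"
    using C(1,2) by (intro exI[of _ "\<lambda>m. case_prod C (prod_decode m)"]) (auto split: prod.split)
qed

lemma openin_P_modification_INT_countable:
  assumes "countable I" "I \<noteq> {}" "\<And>i. i \<in> I \<Longrightarrow> openin (P_modification T) (U i)"
  shows "openin (P_modification T) (\<Inter>i\<in>I. U i)"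
proof -
  have "(\<Inter>i\<in>I. U i) = (\<Inter>n. U (from_nat_into I n))"
    using range_from_nat_into[OF assms(2,1)] by (metis image_image)
  then show ?thesis
    using assms by (simp add: openin_P_modification_INT_nat from_nat_into)
qed

section \<open>Separation and compactness in a P-modification\<close>

lemma Hausdorff_space_P_modification:
  "Hausdorff_space T \<Longrightarrow> Hausdorff_space (P_modification T)"
  by (auto simp: Hausdorff_space_def) (metis openin_imp_openin_P_modification)

text \<open>The complement is a countable intersection of complements of points, each of them open
  in the original Hausdorff topology.\<close>

lemma closedin_P_modification_countable:
  assumes "Hausdorff_space T" "countable S" "S \<subseteq> topspace T"
  shows "closedin (P_modification T) S"
proof (cases "S = {}")
  case False
  have "openin (P_modification T) (\<Inter>x\<in>S. topspace T - {x})"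
    using assms False
    by (intro openin_P_modification_INT_countable openin_imp_openin_P_modification)
       (auto intro!: openin_diff closedin_Hausdorff_singleton)
  moreover have "(\<Inter>x\<in>S. topspace T - {x}) = topspace T - S"
    using False by auto
  ultimately show ?thesis
    using assms by (simp add: closedin_def)
qed auto

text \<open>A countably infinite subset of a compact set would be compact, being closed, and
  discrete, since all its subsets are closed as well.\<close>

lemma compactin_P_modification_imp_finite:
  assumes "Hausdorff_space T" "compactin (P_modification T) K"
  shows "finite K"
proof (rule ccontr)
  assume "infinite K"
  then obtain S where S: "S \<subseteq> K" "countable S" "infinite S"
    by (meson infinite_countable_subset')
  have K: "K \<subseteq> topspace T" using assms(2) by (auto simp: compactin_def)
  have clo: "closedin (P_modification T) A" if "A \<subseteq> S" for A
    using that S K closedin_P_modification_countable[OF assms(1)]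
    by (meson countable_subset subset_trans)
  have "compactin (P_modification T) S"
    using clo[of S] assms(2) S(1) closed_compactin by blast
  \<comment> \<open>This set meets \<open>S\<close> only in \<open>x\<close>, so a subcover of
    \<open>S\<close> must contain a member for every point of \<open>S\<close>.\<close>
  moreover have "openin (P_modification T) (topspace T - (S - {x}))" for x
    using clo[of "S - {x}"] by (auto simp: closedin_def)
  moreover have "S \<subseteq> \<Union> ((\<lambda>x. topspace T - (S - {x})) ` S)"
    using S K by blast
  ultimately obtain F where F: "finite F" "F \<subseteq> (\<lambda>x. topspace T - (S - {x})) ` S" "S \<subseteq> \<Union>F"
    unfolding compactin_def by (metis (no_types, lifting) imageE)
  then obtain J where "finite J" "J \<subseteq> S" "F = (\<lambda>x. topspace T - (S - {x})) ` J"
    by (meson finite_subset_image)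
  then have "S \<subseteq> J" using F(3) by blast
  then show False using S(3) \<open>finite J\<close> finite_subset by blast
qed

section \<open>Maps, products and group structure under P-modification\<close>

lemma continuous_map_P_modification:
  assumes "continuous_map S T f"
  shows "continuous_map (P_modification S) (P_modification T) f"
  unfolding continuous_map_def
proof (intro conjI allI impI)
  show "f \<in> topspace (P_modification S) \<rightarrow> topspace (P_modification T)"
    using assms by (simp add: continuous_map_def)
  fix U assume U: "openin (P_modification T) U"
  show "openin (P_modification S) {x \<in> topspace (P_modification S). f x \<in> U}"
    unfolding openin_P_modification_iff
  proof
    fix x assume x: "x \<in> {x \<in> topspace (P_modification S). f x \<in> U}"
    obtain C :: "nat \<Rightarrow> 'b set"
      where C: "\<And>n. openin T (C n)" "f x \<in> (\<Inter>n. C n)" "(\<Inter>n. C n) \<subseteq> U"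
    proof (rule openin_P_modificationE[OF U, of "f x"])
      show "f x \<in> U" using x by simp
    qed (rule that)
    have "openin S {x \<in> topspace S. f x \<in> C n}" for n
      using assms C(1) by (simp add: continuous_map_def)
    then show "\<exists>C::nat \<Rightarrow> 'a set. (\<forall>n. openin S (C n)) \<and> x \<in> (\<Inter>n. C n) \<and>
       (\<Inter>n. C n) \<subseteq> {x \<in> topspace (P_modification S). f x \<in> U}"
      using C x by (intro exI[of _ "\<lambda>n. {x \<in> topspace S. f x \<in> C n}"]) auto
  qed
qed

text \<open>Countably many boxes around a point contain the box whose sides are the intersections of
  their sides. This carries the continuity of multiplication over to the P-modification.\<close>

lemma openin_prod_P_modification:
  assumes "openin (P_modification (prod_topology S T)) U"
  shows "openin (prod_topology (P_modification S) (P_modification T)) U"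
  unfolding openin_prod_topology_alt
proof (intro allI impI)
  fix x y assume xy: "(x, y) \<in> U"
  obtain C :: "nat \<Rightarrow> ('a \<times> 'b) set"
    where C: "\<And>n. openin (prod_topology S T) (C n)" "(x, y) \<in> (\<Inter>n. C n)" "(\<Inter>n. C n) \<subseteq> U"
    by (rule openin_P_modificationE[OF assms xy]) (rule that)
  have "\<forall>n. \<exists>A B. openin S A \<and> openin T B \<and> x \<in> A \<and> y \<in> B \<and> A \<times> B \<subseteq> C n"
  proof
    fix n
    show "\<exists>A B. openin S A \<and> openin T B \<and> x \<in> A \<and> y \<in> B \<and> A \<times> B \<subseteq> C n"
      using C(2) by (intro openin_prod_topology_alt[THEN iffD1, rule_format, OF C(1)]) auto
  qed
  then obtain A B where AB: "\<And>n. openin S (A n)" "\<And>n. openin T (B n)" "\<And>n. x \<in> A n" "\<And>n. y \<in> B n"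
     "\<And>n. A n \<times> B n \<subseteq> C n" by metis
  have "openin (P_modification S) (\<Inter>n. A n)" "openin (P_modification T) (\<Inter>n. B n)"
    using AB(1,2) by (simp_all add: openin_P_modification_INT_nat openin_imp_openin_P_modification)
  moreover have "(\<Inter>n. A n) \<times> (\<Inter>n. B n) \<subseteq> U"
    using AB(5) by (intro order.trans[OF INT_greatest C(3)]) (meson INT_lower Sigma_mono UNIV_I order.trans)
  ultimately show "\<exists>U' V. openin (P_modification S) U' \<and> openin (P_modification T) V \<and> x \<in> U' \<and> y \<in> V \<and> U' \<times> V \<subseteq> U"
    using AB(3,4) by (meson INT_I)
qed

lemma continuous_map_prod_P_modification:
  assumes "continuous_map (prod_topology S T) X f"
  shows "continuous_map (prod_topology (P_modification S) (P_modification T)) (P_modification X) f"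
  using continuous_map_P_modification[OF assms]
  by (simp add: continuous_map_def openin_prod_P_modification)

lemma topological_abelian_group_P_modification:
  assumes "topological_abelian_group G T"
  shows "topological_abelian_group G (P_modification T)"
proof -
  interpret topological_abelian_group G T by fact
  show ?thesis
    by unfold_locales
      (auto simp: topspace_eq_carrier intro!: Hausdorff_space_P_modification Hausdorff
         continuous_map_prod_P_modification continuous_mult continuous_map_P_modification continuous_inv)
qed

text \<open>The successor cardinal of \<open>natLeq\<close> is the first uncountable ordinal,
  realised on \<open>nat set\<close>; its proper initial segments have smaller cardinality and so
  are countable. The strict part of the order is returned because well-founded recursion runs along
  it.\<close>

lemma omega1_exists:
  obtains I :: "nat set set" and R where
    "\<not> countable I" "wf R" "trans R" "total_on I R" "\<And>a. countable {b. (b, a) \<in> R}"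
proof -
  let ?r = "cardSuc natLeq"
  have co: "Card_order ?r" by (rule cardSuc_Card_order[OF natLeq_Card_order])
  then have wo: "Well_order ?r" by (rule card_order_on_well_order_on)
  have cf: "(card_of (Field ?r), ?r) \<in> ordIso" using co by (rule card_of_Field_ordIso)
  have "\<not> countable (Field ?r)"
  proof
    assume "countable (Field ?r)"
    then have "(card_of (Field ?r), natLeq) \<in> ordLeq" by (simp add: countable_card_le_natLeq)
    then have "(?r, natLeq) \<in> ordLeq" using cf ordIso_ordLeq_trans ordIso_symmetric by blast
    then show False
      using cardSuc_greater[OF natLeq_Card_order] not_ordLess_ordLeq by blast
  qed
  moreover have "wf (?r - Id)"
    using wo by (simp add: well_order_on_def)
  moreover have "trans (?r - Id)"
    using wo unfolding well_order_on_def linear_order_on_def partial_order_on_def preorder_on_def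
    by (simp add: trans_diff_Id)
  moreover have "total_on (Field ?r) (?r - Id)"
    using wo unfolding well_order_on_def linear_order_on_def by (auto simp: total_on_def)
  moreover have "countable {b. (b, a) \<in> ?r - Id}" for a
  proof (cases "a \<in> Field ?r")
    case True
    then have "(card_of (underS ?r a), ?r) \<in> ordLess" by (rule card_of_underS[OF co])
    then have "(card_of (underS ?r a), natLeq) \<in> ordLeq"
      by (rule cardSuc_ordLeq_ordLess[OF natLeq_Card_order card_of_Card_order, THEN iffD1])
    then have "countable (underS ?r a)" by (simp add: countable_card_le_natLeq)
    then show ?thesis by (rule countable_subset[rotated]) (auto simp: underS_def)
  next
    case False
    then have "{b. (b, a) \<in> ?r - Id} = {}" by (auto simp: Field_def)
    then show ?thesis by (simp only: countable_empty)
  qed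
  ultimately show thesis by (rule that)
qed

section \<open>Subgroups of type \<open>G\<^sub>\<delta>\<close>\<close>

context topological_abelian_group
begin

lemma continuous_map_translation:
  "a \<in> carrier G \<Longrightarrow> continuous_map T T (\<lambda>x. a \<otimes> x)"
  using continuous_map_compose[OF _ continuous_mult, of T "\<lambda>x. (a, x)"]
  by (simp add: continuous_map_pairwise o_def topspace_eq_carrier)

lemma continuous_map_divide: "continuous_map (prod_topology T T) T (\<lambda>(x, y). x \<otimes> inv y)"
proof -
  have "continuous_map (prod_topology T T) (prod_topology T T) (\<lambda>(x, y). (x, inv y))"
    using continuous_map_compose[OF continuous_map_snd continuous_inv, of T]
    by (simp add: continuous_map_pairwise o_def case_prod_unfold continuous_map_fst)
  from continuous_map_compose[OF this continuous_mult] show ?thesis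
    by (simp add: o_def case_prod_unfold)
qed

lemma divide_mem_open:
  assumes "openin T U" "\<one> \<in> U"
  shows "\<exists>W. openin T W \<and> \<one> \<in> W \<and> (\<forall>x\<in>W. \<forall>y\<in>W. x \<otimes> inv y \<in> U)"
proof -
  let ?P = "{p \<in> topspace (prod_topology T T). (case p of (x, y) \<Rightarrow> x \<otimes> inv y) \<in> U}"
  have "openin (prod_topology T T) ?P"
    using continuous_map_divide assms(1) openin_continuous_map_preimage by blast
  moreover have "(\<one>, \<one>) \<in> ?P"
    using assms(2) by (simp add: topspace_eq_carrier)
  ultimately have "\<exists>A B. openin T A \<and> openin T B \<and> \<one> \<in> A \<and> \<one> \<in> B \<and> A \<times> B \<subseteq> ?P"
    by (rule openin_prod_topology_alt[THEN iffD1, rule_format])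
  then obtain A B where "openin T A" "openin T B" "\<one> \<in> A" "\<one> \<in> B" "A \<times> B \<subseteq> ?P"
    by (elim exE conjE)
  then have "openin T (A \<inter> B)" "\<one> \<in> A \<inter> B" "\<forall>x\<in>A \<inter> B. \<forall>y\<in>A \<inter> B. x \<otimes> inv y \<in> U"
    by auto
  then show ?thesis by blast
qed

text \<open>Shrinking by division replaces the usual pair of conditions, symmetry and closure of
  products. It alone makes the intersection a subgroup and puts the closure of each set inside its
  predecessor.\<close>

definition neighbourhood_chain :: "(nat \<Rightarrow> 'a set) \<Rightarrow> bool" where
  "neighbourhood_chain V \<longleftrightarrow>
     (\<forall>n. openin T (V n) \<and> \<one> \<in> V n \<and> (\<forall>x\<in>V (Suc n). \<forall>y\<in>V (Suc n). x \<otimes> inv y \<in> V n))"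

lemma neighbourhood_chainD:
  assumes "neighbourhood_chain V"
  shows "openin T (V n)" "\<one> \<in> V n" "V n \<subseteq> carrier G"
    "\<And>x y. x \<in> V (Suc n) \<Longrightarrow> y \<in> V (Suc n) \<Longrightarrow> x \<otimes> inv y \<in> V n"
  using assms openin_subset[of T "V n"] unfolding neighbourhood_chain_def topspace_eq_carrier by simp_all

lemma neighbourhood_chain_antimono:
  assumes "neighbourhood_chain V" "m \<le> n"
  shows "V n \<subseteq> V m"
  using assms(2)
proof (rule lift_Suc_antimono_le[rotated])
  fix n
  show "V (Suc n) \<subseteq> V n"
  proof
    fix x assume "x \<in> V (Suc n)"
    then show "x \<in> V n"
      using neighbourhood_chainD(4)[OF assms(1), of x n \<one>] neighbourhood_chainD(2,3)[OF assms(1), of "Suc n"]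
      by auto
  qed
qed

text \<open>Dependent choice: each new set is a neighbourhood whose quotients stay in the last one,
  cut down by the next \<open>C n\<close>. Hence every G_delta-set around the identity contains a
  G_delta subgroup.\<close>

lemma neighbourhood_chain_exists:
  assumes "\<And>n::nat. openin T (C n)" "\<And>n. \<one> \<in> C n"
  obtains V where "neighbourhood_chain V" "(\<Inter>n. V n) \<subseteq> (\<Inter>n. C n)"
proof -
  have "\<exists>V. \<forall>n. (openin T (V n) \<and> \<one> \<in> V n \<and> V n \<subseteq> C n) \<and>
    (\<forall>x\<in>V (Suc n). \<forall>y\<in>V (Suc n). x \<otimes> inv y \<in> V n)"
  proof (rule dependent_nat_choice)
    show "\<exists>V. openin T V \<and> \<one> \<in> V \<and> V \<subseteq> C 0" using assms by blast
    fix U n assume "openin T U \<and> \<one> \<in> U \<and> U \<subseteq> C n"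
    then obtain W where "openin T W" "\<one> \<in> W" "\<forall>x\<in>W. \<forall>y\<in>W. x \<otimes> inv y \<in> U"
      using divide_mem_open by meson
    then show "\<exists>V. (openin T V \<and> \<one> \<in> V \<and> V \<subseteq> C (Suc n)) \<and> (\<forall>x\<in>V. \<forall>y\<in>V. x \<otimes> inv y \<in> U)"
      using assms by (intro exI[of _ "W \<inter> C (Suc n)"]) auto
  qed
  then obtain V where V: "\<And>n. openin T (V n)" "\<And>n. \<one> \<in> V n" "\<And>n. V n \<subseteq> C n"
    "\<And>n x y. x \<in> V (Suc n) \<Longrightarrow> y \<in> V (Suc n) \<Longrightarrow> x \<otimes> inv y \<in> V n"
    by metis
  show thesis
  proof (rule that)
    show "neighbourhood_chain V" using V by (simp add: neighbourhood_chain_def)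
    show "(\<Inter>n. V n) \<subseteq> (\<Inter>n. C n)" by (intro INF_mono' V(3))
  qed
qed

text \<open>A point \<open>y\<close> of the closure has a translate of \<open>V (Suc n)\<close> as a
  neighbourhood, so some \<open>z = y v\<close> has both \<open>z\<close> and \<open>v\<close> in
  \<open>V (Suc n)\<close>; then \<open>y\<close> is the quotient of \<open>z\<close> by
  \<open>v\<close>.\<close>

lemma neighbourhood_chain_closure:
  assumes V: "neighbourhood_chain V"
  shows "T closure_of (V (Suc n)) \<subseteq> V n"
proof
  fix y assume y: "y \<in> T closure_of (V (Suc n))"
  then have yG: "y \<in> carrier G"
    using closure_of_subset_topspace[of T] topspace_eq_carrier by auto
  let ?O = "{z \<in> topspace T. inv y \<otimes> z \<in> V (Suc n)}"
  have "openin T ?O"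
    using continuous_map_translation[of "inv y"] yG neighbourhood_chainD(1)[OF V]
    by (intro openin_continuous_map_preimage) auto
  moreover have "y \<in> ?O"
    using yG neighbourhood_chainD(2)[OF V] by (simp add: topspace_eq_carrier)
  ultimately obtain z where "z \<in> V (Suc n)" "z \<in> ?O"
    using y unfolding in_closure_of by meson
  then have z: "z \<in> V (Suc n)" "inv y \<otimes> z \<in> V (Suc n)" "z \<in> carrier G"
    by (simp_all add: topspace_eq_carrier)
  then have "z \<otimes> inv (inv y \<otimes> z) \<in> V n"
    using neighbourhood_chainD(4)[OF V] by blast
  moreover have "z \<otimes> inv (inv y \<otimes> z) = y"
  proof -
    have "z \<otimes> inv (inv y \<otimes> z) = z \<otimes> (inv z \<otimes> y)"
      using yG z(3) by (simp add: inv_mult_group)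
    then show ?thesis
      using yG z(3) by (simp add: m_assoc[symmetric])
  qed
  ultimately show "y \<in> V n" by simp
qed

text \<open>Defining it through a chain, not an arbitrary sequence of open sets, makes the subgroup
  closed in \<open>T\<close> and gives compactness arguments open sets that shrink to it in a
  controlled way.\<close>

definition gdelta_subgroup :: "'a set \<Rightarrow> bool" where
  "gdelta_subgroup N \<longleftrightarrow> (\<exists>V. neighbourhood_chain V \<and> N = (\<Inter>n. V n))"

lemma gdelta_subgroup_imp_subgroup:
  assumes "gdelta_subgroup N"
  shows "subgroup N G"
proof -
  obtain V where V: "neighbourhood_chain V" "N = (\<Inter>n. V n)"
    using assms gdelta_subgroup_def by blast
  have one: "\<one> \<in> N" and sub: "N \<subseteq> carrier G"
    using V(2) neighbourhood_chainD(2)[OF V(1)] neighbourhood_chainD(3)[OF V(1), of 0] by auto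
  have divide: "x \<otimes> inv y \<in> N" if "x \<in> N" "y \<in> N" for x y
    using that V(2) neighbourhood_chainD(4)[OF V(1)] by blast
  have inv: "inv y \<in> N" if "y \<in> N" for y
    using divide[OF one that] that sub by auto
  have "x \<otimes> y \<in> N" if "x \<in> N" "y \<in> N" for x y
    using divide[OF that(1) inv[OF that(2)]] that sub by (simp add: subset_iff)
  then show ?thesis
    using one sub inv by (intro subgroupI) auto
qed

lemma gdelta_subgroup_closedin:
  assumes "gdelta_subgroup N"
  shows "closedin T N"
proof -
  obtain V where V: "neighbourhood_chain V" "N = (\<Inter>n. V n)"
    using assms gdelta_subgroup_def by blast
  have "N = (\<Inter>n. T closure_of (V n))"
  proof
    show "N \<subseteq> (\<Inter>n. T closure_of (V n))"
      unfolding V(2) using neighbourhood_chainD(3)[OF V(1)]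
      by (intro INF_mono' closure_of_subset) (simp add: topspace_eq_carrier)
    show "(\<Inter>n. T closure_of (V n)) \<subseteq> N"
      unfolding V(2) using neighbourhood_chain_closure[OF V(1)] by blast
  qed
  then show ?thesis by (simp add: closedin_INT)
qed

text \<open>Translating a sequence of open sets to the identity turns it into a chain and back, so
  the cosets of these subgroups form a base of the P-modification.\<close>

lemma openin_P_modification_group:
  "openin (P_modification T) U \<longleftrightarrow>
     U \<subseteq> carrier G \<and> (\<forall>x\<in>U. \<exists>N. gdelta_subgroup N \<and> (\<forall>n\<in>N. x \<otimes> n \<in> U))"
    (is "?lhs \<longleftrightarrow> ?rhs")
proof
  assume U: ?lhs
  show ?rhs
  proof (intro conjI ballI)
    show sub: "U \<subseteq> carrier G"
      using openin_subset[OF U] by (simp add: topspace_eq_carrier)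
    fix x assume x: "x \<in> U"
    obtain C :: "nat \<Rightarrow> 'a set"
      where C: "\<And>n. openin T (C n)" "x \<in> (\<Inter>n. C n)" "(\<Inter>n. C n) \<subseteq> U"
      using openin_P_modificationE[OF U x] by metis
    have xG: "x \<in> carrier G" using x sub by blast
    define D where "D n = {z \<in> topspace T. x \<otimes> z \<in> C n}" for n
    have "openin T (D n)" for n
      unfolding D_def using continuous_map_translation[OF xG] C(1)
      by (intro openin_continuous_map_preimage)
    moreover have "\<one> \<in> D n" for n
      using C(2) xG by (simp add: D_def topspace_eq_carrier)
    ultimately obtain V where V: "neighbourhood_chain V" "(\<Inter>n. V n) \<subseteq> (\<Inter>n. D n)"
      using neighbourhood_chain_exists[of D] by metis
    have "x \<otimes> z \<in> U" if "z \<in> (\<Inter>n. V n)" for z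
    proof -
      have "z \<in> D n" for n using that V(2) by blast
      then have "x \<otimes> z \<in> (\<Inter>n. C n)" by (simp add: D_def)
      then show ?thesis using C(3) by blast
    qed
    then show "\<exists>N. gdelta_subgroup N \<and> (\<forall>n\<in>N. x \<otimes> n \<in> U)"
      using V(1) unfolding gdelta_subgroup_def by blast
  qed
next
  assume U: ?rhs
  show ?lhs
    unfolding openin_P_modification_iff
  proof
    fix x assume x: "x \<in> U"
    then have xG: "x \<in> carrier G" using U by blast
    obtain N where N: "gdelta_subgroup N" "\<forall>n\<in>N. x \<otimes> n \<in> U" using U x by meson
    obtain V where V: "neighbourhood_chain V" "N = (\<Inter>n. V n)"
      using N(1) gdelta_subgroup_def by blast
    define D where "D n = {z \<in> topspace T. inv x \<otimes> z \<in> V n}" for n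
    have "openin T (D n)" for n
      unfolding D_def using continuous_map_translation[of "inv x"] xG neighbourhood_chainD(1)[OF V(1)]
      by (intro openin_continuous_map_preimage) auto
    moreover have "x \<in> (\<Inter>n. D n)"
      using xG neighbourhood_chainD(2)[OF V(1)] by (simp add: D_def topspace_eq_carrier)
    moreover have "(\<Inter>n. D n) \<subseteq> U"
    proof
      fix z assume "z \<in> (\<Inter>n. D n)"
      then have z: "z \<in> carrier G" "inv x \<otimes> z \<in> N"
        by (auto simp: D_def V(2) topspace_eq_carrier)
      then have "x \<otimes> (inv x \<otimes> z) \<in> U" using N(2) by blast
      then show "z \<in> U" using xG z(1) by (simp add: m_assoc[symmetric])
    qed
    ultimately show "\<exists>C::nat \<Rightarrow> 'a set. (\<forall>n. openin T (C n)) \<and> x \<in> (\<Inter>n. C n) \<and> (\<Inter>n. C n) \<subseteq> U"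
      by (intro exI[of _ D] conjI allI)
  qed
qed

lemma gdelta_subgroup_openin:
  assumes "gdelta_subgroup N"
  shows "openin (P_modification T) N"
  unfolding openin_P_modification_group
  using assms subgroup.subset[OF gdelta_subgroup_imp_subgroup]
    subgroup.m_closed[OF gdelta_subgroup_imp_subgroup] by blast

lemma gdelta_subgroup_subset:
  assumes "openin (P_modification T) U" "\<one> \<in> U"
  obtains N where "gdelta_subgroup N" "N \<subseteq> U"
proof -
  obtain N where N: "gdelta_subgroup N" "\<forall>n\<in>N. \<one> \<otimes> n \<in> U"
    using assms unfolding openin_P_modification_group by blast
  then have "N \<subseteq> U"
    using subgroup.subset[OF gdelta_subgroup_imp_subgroup[OF N(1)]] by (auto simp: subset_iff)
  then show thesis using N(1) that by blast
qed

text \<open>The intersection is P-open as the P-modification is a P-space, hence a neighbourhood of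
  the identity that contains a member of the base. No common chain for the given subgroups has to be
  assembled.\<close>

lemma gdelta_subgroup_INT:
  assumes "countable I" "\<And>i. i \<in> I \<Longrightarrow> gdelta_subgroup (M i)"
  obtains N where "gdelta_subgroup N" "N \<subseteq> (\<Inter>i\<in>I. M i)"
proof (cases "I = {}")
  \<comment> \<open>The empty family occurs at minimal indices of the later recursion, where no
    predecessor contributes a subgroup.\<close>
  case True
  have "openin (P_modification T) (carrier G)"
    using openin_topspace[of "P_modification T"] by (simp add: topspace_eq_carrier)
  then show ?thesis using True gdelta_subgroup_subset[of "carrier G"] that by auto
next
  case False
  have "openin (P_modification T) (\<Inter>i\<in>I. M i)"
    using assms False by (intro openin_P_modification_INT_countable gdelta_subgroup_openin)
  moreover have "\<one> \<in> (\<Inter>i\<in>I. M i)"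
    using assms(2) by (auto intro: subgroup.one_closed gdelta_subgroup_imp_subgroup)
  ultimately show ?thesis using gdelta_subgroup_subset that by metis
qed

end

section \<open>Characters separate points from subgroups\<close>

lemma circle_group_simps [simp]:
  "carrier circle_group = sphere 0 1" "x \<otimes>\<^bsub>circle_group\<^esub> y = x * y" "\<one>\<^bsub>circle_group\<^esub> = 1"
  by (simp_all add: circle_group_def)

context group
begin

lemma
  assumes "\<phi> \<in> hom G circle_group"
  shows character_norm: "x \<in> carrier G \<Longrightarrow> cmod (\<phi> x) = 1"
    and character_mult: "x \<in> carrier G \<Longrightarrow> y \<in> carrier G \<Longrightarrow> \<phi> (x \<otimes> y) = \<phi> x * \<phi> y"
    and character_one: "\<phi> \<one> = 1"
    and character_pow: "x \<in> carrier G \<Longrightarrow> \<phi> (x [^] (n::nat)) = \<phi> x ^ n"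
    and character_inv: "x \<in> carrier G \<Longrightarrow> \<phi> (inv x) = inverse (\<phi> x)"
proof -
  show norm: "cmod (\<phi> x) = 1" if "x \<in> carrier G" for x
    using assms that by (auto simp: hom_def Pi_def)
  show mult: "\<phi> (x \<otimes> y) = \<phi> x * \<phi> y" if "x \<in> carrier G" "y \<in> carrier G" for x y
    using assms that by (simp add: hom_def)
  have "\<phi> \<one> * \<phi> \<one> = \<phi> \<one>" using mult[of \<one> \<one>] by simp
  then show one: "\<phi> \<one> = 1" using norm[of \<one>] by auto
  show "\<phi> (x [^] (n::nat)) = \<phi> x ^ n" if "x \<in> carrier G"
    using that by (induction n) (simp_all add: one mult)
  show "\<phi> (inv x) = inverse (\<phi> x)" if "x \<in> carrier G"
  proof -
    have "\<phi> x * \<phi> (inv x) = 1" using mult[of x "inv x"] that one by simp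
    then show ?thesis by (simp add: inverse_unique)
  qed
qed

end

text \<open>The subgroups of the integers are cyclic, by division with remainder. Applied to the
  exponents \<open>m\<close> for which \<open>g [^] m\<close> lies in a given subgroup,
  \<open>k\<close> is the order of \<open>g\<close> modulo it, with 0 standing for infinite
  order.\<close>

lemma int_ideal_principal:
  fixes P :: "int \<Rightarrow> bool"
  assumes zero: "P 0" and diff: "\<And>a b. P a \<Longrightarrow> P b \<Longrightarrow> P (a - b)"
  shows "\<exists>k::nat. \<forall>m. P m \<longleftrightarrow> int k dvd m"
proof (cases "\<exists>m. m \<noteq> 0 \<and> P m")
  case False
  then have "P m \<longleftrightarrow> int 0 dvd m" for m using zero by auto
  then show ?thesis by blast
next
  case True
  have neg: "P (- a)" if "P a" for a using diff[OF zero that] by simp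
  have add: "P (a + b)" if "P a" "P b" for a b using diff[OF that(1) neg[OF that(2)]] by simp
  obtain m where m: "m \<noteq> 0" "P m" using True by blast
  define k where "k = (LEAST k::nat. 0 < k \<and> P (int k))"
  have "0 < nat \<bar>m\<bar> \<and> P (int (nat \<bar>m\<bar>))" using m neg by (auto simp: abs_if)
  then have k: "0 < k" "P (int k)" and least: "\<And>j. 0 < j \<Longrightarrow> P (int j) \<Longrightarrow> k \<le> j"
    unfolding k_def by (metis (mono_tags, lifting) LeastI, metis (mono_tags, lifting) LeastI,
      metis (mono_tags, lifting) Least_le)
  have mult_nat: "P (int k * int n)" for n
    by (induction n) (use zero k(2) add in \<open>auto simp: algebra_simps\<close>)
  have mult: "P (int k * q)" for q
    using mult_nat neg[OF mult_nat] by (cases q rule: int_cases2) simp_all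
  have "int k dvd a" if "P a" for a
  proof -
    have "P (a - int k * (a div int k))" by (intro diff that mult)
    then have P: "P (a mod int k)" by (simp only: minus_mult_div_eq_mod)
    have bounds: "0 \<le> a mod int k" "a mod int k < int k" using k(1) by simp_all
    have "a mod int k = 0"
    proof (rule ccontr)
      assume "a mod int k \<noteq> 0"
      then have "0 < nat (a mod int k)" using bounds(1) by simp
      moreover have "P (int (nat (a mod int k)))" using P bounds(1) by simp
      ultimately have "k \<le> nat (a mod int k)" by (rule least)
      then show False using bounds by linarith
    qed
    then show ?thesis by auto
  qed
  moreover have "P a" if "int k dvd a" for a using that mult by (auto simp: dvd_def)
  ultimately show ?thesis by blast
qed

section \<open>Extension of partial characters by Zorn's lemma\<close>

context comm_group
begin

text \<open>Characters of subgroups are encoded by their graphs, so that Zorn's lemma applies to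
  inclusion and the union of a chain is again such a graph.\<close>

definition partial_character :: "('a \<times> complex) set \<Rightarrow> bool" where
  "partial_character S \<longleftrightarrow> S \<subseteq> carrier G \<times> sphere 0 1 \<and> (\<one>, 1) \<in> S \<and>
     (\<forall>x u y v. (x, u) \<in> S \<longrightarrow> (y, v) \<in> S \<longrightarrow> (x \<otimes> y, u * v) \<in> S) \<and>
     (\<forall>x u. (x, u) \<in> S \<longrightarrow> (inv x, inverse u) \<in> S) \<and> (\<forall>u. (\<one>, u) \<in> S \<longrightarrow> u = 1)"

lemma partial_characterD:
  assumes "partial_character S"
  shows "(x, u) \<in> S \<Longrightarrow> x \<in> carrier G" "(x, u) \<in> S \<Longrightarrow> cmod u = 1" "(\<one>, 1) \<in> S"
    "(x, u) \<in> S \<Longrightarrow> (y, v) \<in> S \<Longrightarrow> (x \<otimes> y, u * v) \<in> S"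
    "(x, u) \<in> S \<Longrightarrow> (inv x, inverse u) \<in> S" "(\<one>, u) \<in> S \<Longrightarrow> u = 1"
proof -
  have "S \<subseteq> carrier G \<times> sphere 0 1" using assms by (simp add: partial_character_def)
  then show "(x, u) \<in> S \<Longrightarrow> x \<in> carrier G" "(x, u) \<in> S \<Longrightarrow> cmod u = 1" by auto
  show "(\<one>, 1) \<in> S" "(x, u) \<in> S \<Longrightarrow> (y, v) \<in> S \<Longrightarrow> (x \<otimes> y, u * v) \<in> S"
    "(x, u) \<in> S \<Longrightarrow> (inv x, inverse u) \<in> S" "(\<one>, u) \<in> S \<Longrightarrow> u = 1"
    using assms unfolding partial_character_def by meson+
qed

text \<open>The quotient of two values at the same point is a value at the identity; this is why the
  definition restricts only the fibre over \<open>\<one>\<close>.\<close>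

lemma partial_character_unique:
  assumes "partial_character S" "(x, u) \<in> S" "(x, v) \<in> S"
  shows "u = v"
proof -
  have "(x \<otimes> inv x, u * inverse v) \<in> S"
    using partial_characterD(4,5)[OF assms(1)] assms(2,3) by blast
  then have "(\<one>, u * inverse v) \<in> S"
    using partial_characterD(1)[OF assms(1,2)] by simp
  then have "u * inverse v = 1" by (rule partial_characterD(6)[OF assms(1)])
  then have "inverse u = inverse v" by (rule inverse_unique)
  then show ?thesis by simp
qed

lemma partial_character_int_pow:
  assumes S: "partial_character S" "(x, u) \<in> S"
  shows "(x [^] (q::int), u powi q) \<in> S"
proof -
  have nat: "(x [^] (n::nat), u ^ n) \<in> S" for n
  proof (induction n)
    case 0
    then show ?case using partial_characterD(3)[OF S(1)] by simp
  next
    case (Suc n)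
    then show ?case using partial_characterD(4)[OF S(1) Suc S(2)] by (simp add: mult.commute)
  qed
  show ?thesis
  proof (cases q rule: int_cases2)
    case (nonneg n)
    then show ?thesis using nat[of n] by (simp add: int_pow_int)
  next
    case (nonpos n)
    then show ?thesis
      using partial_characterD(5)[OF S(1) nat[of n]] partial_characterD(1)[OF S]
      by (simp add: int_pow_neg int_pow_int power_int_minus)
  qed
qed

text \<open>The extension lives on the subgroup generated by the old domain and \<open>g\<close>.
  The hypothesis \<open>compat\<close> says that the powers of \<open>z\<close> agree with the old
  values wherever a power of \<open>g\<close> was already in the domain.\<close>

lemma partial_character_adjoin:
  assumes S: "partial_character S" and g: "g \<in> carrier G" and z: "cmod z = 1"
    and compat: "\<And>(m::int) u. (g [^] m, u) \<in> S \<Longrightarrow> u = z powi m"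
  obtains S' where "partial_character S'" "S \<subseteq> S'" "(g, z) \<in> S'"
proof -
  define S' where "S' = {(x \<otimes> g [^] m, u * z powi m) |x u (m::int). (x, u) \<in> S}"
  note D = partial_characterD[OF S]
  have z0: "z \<noteq> 0" using z by auto
  have I: "(x \<otimes> g [^] m, u * z powi m) \<in> S'" if "(x, u) \<in> S" for x u and m :: int
    using that unfolding S'_def by blast
  have "partial_character S'"
    unfolding partial_character_def
  proof (intro conjI allI impI)
    show "S' \<subseteq> carrier G \<times> sphere 0 1"
      using D(1,2) g z by (auto simp: S'_def norm_mult norm_power_int)
    show "(\<one>, 1) \<in> S'" using I[OF D(3), of 0] by simp
  next
    fix p u q v assume "(p, u) \<in> S'" "(q, v) \<in> S'"
    then obtain x a m y b n where *: "p = x \<otimes> g [^] (m::int)" "u = a * z powi m" "(x, a) \<in> S"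
       "q = y \<otimes> g [^] (n::int)" "v = b * z powi n" "(y, b) \<in> S"
      unfolding S'_def by blast
    have "p \<otimes> q = (x \<otimes> y) \<otimes> g [^] (m + n)"
      using * D(1) g by (simp add: int_pow_mult m_ac)
    moreover have "u * v = (a * b) * z powi (m + n)"
      using * z0 by (simp add: power_int_add)
    ultimately show "(p \<otimes> q, u * v) \<in> S'"
      using I[OF D(4)[OF *(3,6)]] by simp
  next
    fix p u assume "(p, u) \<in> S'"
    then obtain x a m where *: "p = x \<otimes> g [^] (m::int)" "u = a * z powi m" "(x, a) \<in> S"
      unfolding S'_def by blast
    have "inv p = inv x \<otimes> g [^] (- m)"
      using * D(1) g by (simp add: inv_mult int_pow_neg)
    moreover have "inverse u = inverse a * z powi (- m)"
      using * by (simp add: power_int_minus)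
    ultimately show "(inv p, inverse u) \<in> S'"
      using I[OF D(5)[OF *(3)]] by simp
  next
    fix w assume "(\<one>, w) \<in> S'"
    then obtain x a m where *: "\<one> = x \<otimes> g [^] (m::int)" "w = a * z powi m" "(x, a) \<in> S"
      unfolding S'_def by blast
    have xG: "x \<in> carrier G" using D(1) * by blast
    \<comment> \<open>A relation in the enlarged subgroup puts a power of \<open>g\<close> into the
      old domain, where \<open>compat\<close> fixes its value and cancels the factor
      \<open>a\<close>.\<close>
    have "g [^] m = inv x"
      using *(1) xG g by (metis inv_equality inv_inv int_pow_closed inv_closed m_comm)
    then have "(g [^] m, inverse a) \<in> S" using D(5)[OF *(3)] by simp
    then have "inverse a = z powi m" by (rule compat)
    then show "w = 1" using *(2) D(2)[OF *(3)] by (metis norm_zero right_inverse zero_neq_one)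
  qed
  moreover have "S \<subseteq> S'"
  proof
    fix p assume "p \<in> S"
    then obtain x u where "p = (x, u)" "(x, u) \<in> S" by (cases p) auto
    then show "p \<in> S'" using I[of x u 0] D(1) by simp
  qed
  moreover have "(g, z) \<in> S'" using I[OF D(3), of 1] g by simp
  ultimately show thesis by (rule that)
qed

lemma unit_root_exists:
  assumes "cmod u = 1" "0 < (k::nat)"
  obtains z where "cmod z = 1" "z ^ k = u"
proof
  show "cmod (cis (Arg u / k)) = 1" by simp
  have "cis (Arg u / k) ^ k = cis (Arg u)" using assms(2) by (simp add: Complex.DeMoivre)
  also have "\<dots> = u" using rcis_cmod_Arg[of u] assms(1) by (simp add: rcis_def)
  finally show "cis (Arg u / k) ^ k = u" .
qed

text \<open>If \<open>g\<close> has order \<open>k\<close> modulo the domain of a maximal graph, the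
  one constraint on its value is that the \<open>k\<close>-th power equal the value \<open>u\<close>
  at \<open>g [^] k\<close>. Roots exist on the circle, so maximality forces the domain to be
  everything.\<close>

lemma partial_character_total:
  assumes S: "partial_character S"
  obtains \<psi> where "\<psi> \<in> hom G circle_group" "\<And>x u. (x, u) \<in> S \<Longrightarrow> \<psi> x = u"
proof -
  let ?A = "{M. partial_character M \<and> S \<subseteq> M}"
  have "\<exists>M\<in>?A. \<forall>X\<in>?A. M \<subseteq> X \<longrightarrow> X = M"
  proof (rule subset_Zorn_nonempty)
    show "?A \<noteq> {}" using S by blast
    fix C assume ne: "C \<noteq> {}" and chain: "subset.chain ?A C"
    have pc: "partial_character M" "S \<subseteq> M" if "M \<in> C" for M
      using that chain unfolding subset_chain_def by auto
    have mult: "(x \<otimes> y, u * v) \<in> \<Union>C" if xy: "(x, u) \<in> \<Union>C" "(y, v) \<in> \<Union>C" for x u y v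
    proof -
      obtain M M' where M: "(x, u) \<in> M" "M \<in> C" "(y, v) \<in> M'" "M' \<in> C" using xy by (elim UnionE)
      have "M \<subseteq> M' \<or> M' \<subseteq> M" using chain M(2,4) by (simp add: subset_chain_def)
      then have "\<exists>M''\<in>C. (x, u) \<in> M'' \<and> (y, v) \<in> M''"
      proof
        assume "M \<subseteq> M'"
        then show ?thesis using M(1,3,4) by (intro bexI[of _ M']) auto
      next
        assume "M' \<subseteq> M"
        then show ?thesis using M(1,2,3) by (intro bexI[of _ M]) auto
      qed
      then obtain M'' where M'': "M'' \<in> C" "(x, u) \<in> M''" "(y, v) \<in> M''" by (elim bexE conjE)
      show ?thesis
        using partial_characterD(4)[OF pc(1)[OF M''(1)] M''(2,3)] M''(1) by (rule UnionI[rotated])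
    qed
    have "partial_character (\<Union>C)"
      unfolding partial_character_def
    proof (intro conjI allI impI)
      show "\<Union>C \<subseteq> carrier G \<times> sphere 0 1"
        using pc(1) by (intro Union_least) (simp add: partial_character_def)
      obtain M where M: "M \<in> C" using ne by blast
      show "(\<one>, 1) \<in> \<Union>C" using M partial_characterD(3)[OF pc(1)[OF M]] by (rule UnionI)
      show "(inv x, inverse u) \<in> \<Union>C" if "(x, u) \<in> \<Union>C" for x u
        using that pc(1) by (meson UnionE UnionI partial_characterD(5))
      show "u = 1" if "(\<one>, u) \<in> \<Union>C" for u
        using that pc(1) by (meson UnionE partial_characterD(6))
    qed (rule mult)
    moreover have "S \<subseteq> \<Union>C" using ne pc(2) by (meson Union_upper ex_in_conv subset_trans)
    ultimately show "\<Union>C \<in> ?A" by simp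
  qed
  then obtain M where M: "partial_character M" "S \<subseteq> M"
    and max: "\<And>X. partial_character X \<Longrightarrow> M \<subseteq> X \<Longrightarrow> X = M"
    by (smt (verit) mem_Collect_eq subset_trans)
  note D = partial_characterD[OF M(1)]
  have total: "\<exists>z. (g, z) \<in> M" if g: "g \<in> carrier G" for g
  proof -
    let ?P = "\<lambda>m::int. \<exists>u. (g [^] m, u) \<in> M"
    have P0: "?P 0" using D(3) by auto
    have Pd: "?P (a - b)" if ab: "?P a" "?P b" for a b
    proof -
      obtain u v where "(g [^] a, u) \<in> M" "(g [^] b, v) \<in> M" using ab by blast
      then have "(g [^] a \<otimes> inv (g [^] b), u * inverse v) \<in> M" using D(4,5) by blast
      then show ?thesis using g by (auto simp: int_pow_diff)
    qed
    obtain k :: nat where k: "\<And>m. ?P m \<longleftrightarrow> int k dvd m"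
      using int_ideal_principal[of ?P, OF P0 Pd] by auto
    obtain u where u: "(g [^] (int k), u) \<in> M" using k[of "int k"] by auto
    \<comment> \<open>For \<open>k = 0\<close> no nontrivial power relation constrains the value,
      and 1 is chosen.\<close>
    have "\<exists>z. cmod z = 1 \<and> z ^ k = u"
    proof (cases "k = 0")
      case True
      then have "u = 1" using u D(6) by simp
      then show ?thesis using True by (intro exI[of _ 1]) simp
    next
      case False
      then show ?thesis using unit_root_exists[OF D(2)[OF u], of k] by blast
    qed
    then obtain z where z: "cmod z = 1" "z ^ k = u" by blast
    have "v = z powi m" if "(g [^] m, v) \<in> M" for m v
    proof -
      have "int k dvd m" using k[of m] that by blast
      then obtain q where q: "m = int k * q" by (auto simp: dvd_def)
      have "(g [^] m, u powi q) \<in> M"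
        using partial_character_int_pow[OF M(1) u, of q] g by (simp add: int_pow_pow q)
      then have "v = u powi q" using partial_character_unique[OF M(1) that] by blast
      then show ?thesis using z(2) q by (simp add: power_int_mult)
    qed
    then obtain M' where "partial_character M'" "M \<subseteq> M'" "(g, z) \<in> M'"
      using partial_character_adjoin[OF M(1) g z(1)] by metis
    then show ?thesis using max by blast
  qed
  define \<psi> where "\<psi> x = (SOME u. (x, u) \<in> M)" for x
  have \<psi>: "(x, \<psi> x) \<in> M" if "x \<in> carrier G" for x
    using total[OF that] unfolding \<psi>_def by (rule someI_ex)
  show thesis
  proof (rule that)
    have "\<psi> (x \<otimes> y) = \<psi> x * \<psi> y" if "x \<in> carrier G" "y \<in> carrier G" for x y
      using partial_character_unique[OF M(1)] \<psi> D(4) that by (meson m_closed)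
    then show "\<psi> \<in> hom G circle_group"
      using D(2)[OF \<psi>] by (simp add: hom_def)
    fix x u assume "(x, u) \<in> S"
    then have xu: "(x, u) \<in> M" using M(2) by blast
    show "\<psi> x = u" by (rule partial_character_unique[OF M(1) \<psi>[OF D(1)[OF xu]] xu])
  qed
qed

text \<open>The trivial character of \<open>N\<close> is first extended to \<open>x\<close> with a
  value other than 1, which the order \<open>k\<close> of \<open>x\<close> modulo \<open>N\<close>
  allows, and then to the whole group.\<close>

lemma character_separates_subgroup:
  assumes N: "subgroup N G" and x: "x \<in> carrier G" "x \<notin> N"
  obtains \<psi> where "\<psi> \<in> hom G circle_group" "\<And>y. y \<in> N \<Longrightarrow> \<psi> y = 1" "\<psi> x \<noteq> 1"
proof -
  have S: "partial_character (N \<times> {1})"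
    using subgroup.one_closed[OF N] subgroup.m_closed[OF N] subgroup.m_inv_closed[OF N] subgroup.subset[OF N]
    by (auto simp: partial_character_def)
  let ?P = "\<lambda>m::int. x [^] m \<in> N"
  have P0: "?P 0" using subgroup.one_closed[OF N] by simp
  have Pd: "?P (a - b)" if "?P a" "?P b" for a b
    using that x(1) subgroup.m_closed[OF N] subgroup.m_inv_closed[OF N] by (simp add: int_pow_diff)
  obtain k :: nat where k: "\<And>m. ?P m \<longleftrightarrow> int k dvd m"
    using int_ideal_principal[of ?P, OF P0 Pd] by auto
  have k1: "k \<noteq> 1" using k[of 1] x by (auto simp: int_pow_1)
  \<comment> \<open>For infinite order the value -1 will do; for finite order \<open>k\<close> a
    primitive \<open>k\<close>-th root of unity, which differs from 1 since
    \<open>x \<notin> N\<close> excludes \<open>k = 1\<close>.\<close>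
  have "\<exists>z. cmod z = 1 \<and> z \<noteq> 1 \<and> z ^ k = 1"
  proof (cases "k = 0")
    case True
    then show ?thesis by (intro exI[of _ "-1"]) auto
  next
    case False
    then have "k > 1" using k1 by simp
    have "cis (2 * pi / k) \<noteq> 1"
    proof
      assume "cis (2 * pi / k) = 1"
      then obtain n :: int where "2 * pi / k = 2 * pi * n"
        by (metis cis.simps(1) cos_one_2pi_int one_complex.simps(1) mult.commute mult.assoc)
      then have "1 = real k * of_int n" using \<open>k > 1\<close> by (simp add: field_simps)
      then have "1 = int k * n" by (metis of_int_1 of_int_eq_iff of_int_mult of_int_of_nat_eq)
      then show False using \<open>k > 1\<close> by (metis dvd_triv_left int_dvd_int_iff nat_dvd_1_iff_1 of_nat_1 less_irrefl)
    qed
    moreover have "cis (2 * pi / k) ^ k = 1" using \<open>k > 1\<close> by (simp add: Complex.DeMoivre)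
    ultimately show ?thesis by (intro exI[of _ "cis (2 * pi / k)"]) simp
  qed
  then obtain z where z: "cmod z = 1" "z \<noteq> 1" "z ^ k = 1" by blast
  have "u = z powi m" if "(x [^] m, u) \<in> N \<times> {1}" for m u
  proof -
    have "int k dvd m" using that k[of m] by auto
    then obtain q where "m = int k * q" by (auto simp: dvd_def)
    then show ?thesis using that z(3) by (simp add: power_int_mult)
  qed
  then obtain S' where S': "partial_character S'" "N \<times> {1} \<subseteq> S'" "(x, z) \<in> S'"
    using partial_character_adjoin[OF S x(1) z(1)] by metis
  obtain \<psi> where \<psi>: "\<psi> \<in> hom G circle_group" "\<And>x u. (x, u) \<in> S' \<Longrightarrow> \<psi> x = u"
    using partial_character_total[OF S'(1)] by metis
  show thesis
  proof (rule that[OF \<psi>(1)])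
    show "\<psi> y = 1" if "y \<in> N" for y using that S'(2) \<psi>(2) by blast
    show "\<psi> x \<noteq> 1" using \<psi>(2)[OF S'(3)] z(2) by simp
  qed
qed

end

section \<open>Characters of groups with a pointwise topology\<close>

lemma mult_cnj_unit: "cmod z = 1 \<Longrightarrow> z * cnj z = 1"
  by (simp add: complex_norm_square[symmetric])

context group
begin

lemma sum_character_translates:
  assumes l: "\<And>p. p \<in> set l \<Longrightarrow> snd p \<in> hom G circle_group" and x: "x \<in> carrier G" and g: "g \<in> carrier G"
  shows "(\<Sum>k<n. \<Sum>p\<leftarrow>l. fst p * snd p (x \<otimes> g [^] (k::nat))) =
    (\<Sum>p\<leftarrow>l. fst p * (\<Sum>k<n. snd p g ^ k) * snd p x)"
  using l
proof (induction l)
  case (Cons p l)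
  have "snd p (x \<otimes> g [^] (k::nat)) = snd p x * snd p g ^ k" for k
    using Cons.prems[of p] x g by (simp add: character_mult character_pow)
  then have "(\<Sum>k<n. fst p * snd p (x \<otimes> g [^] (k::nat))) = fst p * (\<Sum>k<n. snd p g ^ k) * snd p x"
    by (simp add: sum_distrib_left sum_distrib_right mult_ac)
  then show ?case using Cons by (simp add: sum.distrib)
qed simp

text \<open>Averaging over the powers of some \<open>g\<close> with \<open>\<eta> g \<noteq> 1\<close> fixes the constant \<open>1\<close>,
  kills \<open>\<eta>\<close> in the limit and only rescales the other characters.\<close>

lemma nontrivial_characters_far_from_one:
  assumes "\<And>p. p \<in> set l \<Longrightarrow> snd p \<in> hom G circle_group \<and> (\<exists>g\<in>carrier G. snd p g \<noteq> 1)"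
    and "\<And>x. x \<in> carrier G \<Longrightarrow> cmod (1 - (\<Sum>p\<leftarrow>l. fst p * snd p x)) \<le> \<delta>"
  shows "1 \<le> \<delta>"
  using assms
proof (induction "length l" arbitrary: l \<delta>)
  case 0
  then show ?case using 0(3)[of \<one>] by simp
next
  case (Suc j ql)
  then obtain q l where ql: "ql = q # l" "length l = j" by (metis length_Suc_conv)
  note prems = Suc.prems[unfolded ql(1)]
  obtain c \<eta> where q: "q = (c, \<eta>)" by (cases q)
  have \<eta>: "\<eta> \<in> hom G circle_group" using prems(1)[of q] q by simp
  obtain g where g: "g \<in> carrier G" "\<eta> g \<noteq> 1" using prems(1)[of q] q by auto
  \<comment> \<open>The geometric sums of \<open>\<eta> g\<close> are bounded by 2 / |1 -
    \<open>\<eta> g\<close>| for every length, so \<open>\<eta>\<close> contributes at most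
    \<open>K / n\<close> to the mean over \<open>n\<close> translates.\<close>
  define K where "K = cmod c * (2 / cmod (1 - \<eta> g))"
  \<comment> \<open>The mean without \<open>q\<close> is a sum over a list shorter by one, with new
    coefficients depending on \<open>n\<close>; the induction hypothesis applies to it with this
    slightly worse bound, and \<open>n\<close> is then taken large.\<close>
  have step: "1 \<le> \<delta> + K / real n" if n: "0 < n" for n :: nat
  proof (rule Suc.hyps(1))
    let ?m = "\<lambda>p :: complex \<times> ('a \<Rightarrow> complex). (fst p * ((\<Sum>k<n. snd p g ^ k) / of_nat n), snd p)"
    show "j = length (map ?m l)" using ql(2) by simp
    fix p assume "p \<in> set (map ?m l)"
    then obtain p' where "p' \<in> set l" "snd p = snd p'" by auto
    then show "snd p \<in> hom G circle_group \<and> (\<exists>g\<in>carrier G. snd p g \<noteq> 1)"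
      using prems(1)[of p'] by simp
  next
    let ?m = "\<lambda>p :: complex \<times> ('a \<Rightarrow> complex). (fst p * ((\<Sum>k<n. snd p g ^ k) / of_nat n), snd p)"
    fix x assume x: "x \<in> carrier G"
    let ?f = "\<lambda>k. 1 - (\<Sum>p\<leftarrow>q # l. fst p * snd p (x \<otimes> g [^] (k::nat)))"
    let ?S = "\<Sum>k<n. \<eta> g ^ k"
    have "cmod (\<Sum>k<n. ?f k) \<le> (\<Sum>k<n. \<delta>)"
      using prems(2) x g(1) by (intro sum_norm_le) blast
    then have 1: "cmod (\<Sum>k<n. ?f k) \<le> n * \<delta>" by simp
    have "(\<Sum>k<n. ?f k) = n - (\<Sum>k<n. (\<Sum>p\<leftarrow>q # l. fst p * snd p (x \<otimes> g [^] (k::nat))))"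
      by (simp add: sum_subtractf)
    also have "(\<Sum>k<n. (\<Sum>p\<leftarrow>q # l. fst p * snd p (x \<otimes> g [^] (k::nat)))) =
       (\<Sum>p\<leftarrow>q # l. fst p * (\<Sum>k<n. snd p g ^ k) * snd p x)"
      using prems(1) x g(1) by (intro sum_character_translates) blast+
    also have "\<dots> = c * ?S * \<eta> x + (\<Sum>p\<leftarrow>l. fst p * (\<Sum>k<n. snd p g ^ k) * snd p x)"
      by (simp add: q)
    also have "(\<Sum>p\<leftarrow>l. fst p * (\<Sum>k<n. snd p g ^ k) * snd p x) =
       n * (\<Sum>p\<leftarrow>map ?m l. fst p * snd p x)"
      using n by (simp add: o_def sum_list_const_mult[symmetric])
    finally have E: "of_nat n * (1 - (\<Sum>p\<leftarrow>map ?m l. fst p * snd p x)) = (\<Sum>k<n. ?f k) + c * ?S * \<eta> x"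
      by (simp add: algebra_simps)
    have "n * cmod (1 - (\<Sum>p\<leftarrow>map ?m l. fst p * snd p x)) = cmod ((\<Sum>k<n. ?f k) + c * ?S * \<eta> x)"
      unfolding E[symmetric] by (simp only: norm_mult norm_of_nat)
    also have "\<dots> \<le> cmod (\<Sum>k<n. ?f k) + cmod (c * ?S * \<eta> x)"
      by (rule norm_triangle_ineq)
    also have "cmod (c * ?S * \<eta> x) \<le> K"
    proof -
      have "(1 - \<eta> g) * ?S = 1 - \<eta> g ^ n" by (rule one_diff_power_eq[symmetric])
      then have "cmod (1 - \<eta> g) * cmod ?S = cmod (1 - \<eta> g ^ n)" by (metis norm_mult)
      also have "\<dots> \<le> 2"
        using norm_triangle_ineq4[of 1 "\<eta> g ^ n"] character_norm[OF \<eta> g(1)] by (simp add: norm_power)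
      finally have "cmod ?S \<le> 2 / cmod (1 - \<eta> g)"
        using g(2) by (simp add: field_simps)
      then have "cmod c * cmod ?S \<le> K" unfolding K_def by (rule mult_left_mono) simp
      then show ?thesis
        using character_norm[OF \<eta> x] by (simp add: norm_mult)
    qed
    finally have "n * cmod (1 - (\<Sum>p\<leftarrow>map ?m l. fst p * snd p x)) \<le> n * \<delta> + K"
      using 1 by linarith
    then show "cmod (1 - (\<Sum>p\<leftarrow>map ?m l. fst p * snd p x)) \<le> \<delta> + K / real n"
      using n by (simp add: field_simps)
  qed
  show "1 \<le> \<delta>"
  proof (rule ccontr)
    assume "\<not> 1 \<le> \<delta>"
    then have \<delta>: "0 < 1 - \<delta>" by simp
    obtain n :: nat where n: "K / (1 - \<delta>) < n" using reals_Archimedean2 by blast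
    have "0 \<le> K" by (simp add: K_def)
    then have n0: "0 < n" using n \<delta> by (metis divide_nonneg_pos le_less_trans of_nat_0_less_iff)
    have "K < n * (1 - \<delta>)" using n \<delta> by (simp add: field_simps)
    then have "K / n < 1 - \<delta>" using n0 by (simp add: field_simps)
    then show False using step[OF n0] by linarith
  qed
qed

end

text \<open>Products expand termwise. Lists allow repeated frequencies, so equal terms never have to
  be collected.\<close>

lemma trigonometric_sum_mult:
  fixes b :: "'a \<Rightarrow> 'd \<Rightarrow> complex"
  assumes mult: "\<forall>x\<in>A. \<forall>y\<in>A. m x y \<in> A \<and> (\<forall>\<phi>\<in>D. b (m x y) \<phi> = b x \<phi> * b y \<phi>)"
    and "snd ` set l \<subseteq> A" "snd ` set l' \<subseteq> A"
  obtains l'' where "snd ` set l'' \<subseteq> A"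
    "\<And>\<phi>. \<phi> \<in> D \<Longrightarrow> (\<Sum>p\<leftarrow>l''. fst p * b (snd p) \<phi>) =
       (\<Sum>p\<leftarrow>l. fst p * b (snd p) \<phi>) * (\<Sum>p\<leftarrow>l'. fst p * b (snd p) \<phi>)"
proof -
  have single: "(\<Sum>p\<leftarrow>map (\<lambda>p'. (fst p * fst p', m (snd p) (snd p'))) l'. fst p * b (snd p) \<phi>) =
      fst p * b (snd p) \<phi> * (\<Sum>p\<leftarrow>l'. fst p * b (snd p) \<phi>)"
    if "snd p \<in> A" "\<phi> \<in> D" for p \<phi>
    using assms(3) that mult by (induction l') (auto simp: algebra_simps)
  have "\<exists>l''. snd ` set l'' \<subseteq> A \<and> (\<forall>\<phi>\<in>D. (\<Sum>p\<leftarrow>l''. fst p * b (snd p) \<phi>) =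
       (\<Sum>p\<leftarrow>l. fst p * b (snd p) \<phi>) * (\<Sum>p\<leftarrow>l'. fst p * b (snd p) \<phi>))"
    using assms(2)
  proof (induction l)
    case Nil
    then show ?case by (intro exI[of _ "[]"]) simp
  next
    case (Cons p l)
    then obtain l'' where l'': "snd ` set l'' \<subseteq> A" "\<forall>\<phi>\<in>D. (\<Sum>p\<leftarrow>l''. fst p * b (snd p) \<phi>) =
       (\<Sum>p\<leftarrow>l. fst p * b (snd p) \<phi>) * (\<Sum>p\<leftarrow>l'. fst p * b (snd p) \<phi>)" by auto
    let ?q = "map (\<lambda>p'. (fst p * fst p', m (snd p) (snd p'))) l'"
    have p: "snd p \<in> A" using Cons.prems by simp
    have "snd ` set ?q \<subseteq> A" using p assms(3) mult by auto
    then show ?case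
      using l'' single[OF p] by (intro exI[of _ "?q @ l''"]) (simp add: algebra_simps image_Un)
  qed
  then show thesis using that by blast
qed

text \<open>This is the duality of precompact groups: a topology induced by a group of characters
  has no other continuous characters. It is stated for a pairing, with \<open>cont\<close>
  expressing continuity at the identity for the topology that \<open>A\<close> induces on
  \<open>D\<close>; no completion of \<open>D\<close> is formed.\<close>

lemma character_eq_pairing:
  fixes A :: "('a, 'b) monoid_scheme" and D :: "('d, 'e) monoid_scheme" and b :: "'a \<Rightarrow> 'd \<Rightarrow> complex"
  assumes A: "group A" and D: "group D"
    and left: "\<And>a. a \<in> carrier A \<Longrightarrow> b a \<in> hom D circle_group"
    and right: "\<And>\<phi>. \<phi> \<in> carrier D \<Longrightarrow> (\<lambda>a. b a \<phi>) \<in> hom A circle_group"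
    and \<xi>: "\<xi> \<in> hom D circle_group"
    and cont: "\<And>\<epsilon>. 0 < \<epsilon> \<Longrightarrow> \<exists>F \<delta>. finite F \<and> F \<subseteq> carrier A \<and> 0 < \<delta> \<and>
      (\<forall>\<phi>\<in>carrier D. (\<forall>a\<in>F. dist (b a \<phi>) 1 < \<delta>) \<longrightarrow> dist (\<xi> \<phi>) 1 < \<epsilon>)"
  obtains a where "a \<in> carrier A" "\<And>\<phi>. \<phi> \<in> carrier D \<Longrightarrow> \<xi> \<phi> = b a \<phi>"
proof -
  interpret A: group A by fact
  interpret D: group D by fact
  have "\<forall>n::nat. \<exists>F \<delta>. finite F \<and> F \<subseteq> carrier A \<and> 0 < \<delta> \<and>
      (\<forall>\<phi>\<in>carrier D. (\<forall>a\<in>F. dist (b a \<phi>) 1 < \<delta>) \<longrightarrow> dist (\<xi> \<phi>) 1 < inverse (Suc n))"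
    using cont by simp
  then obtain F \<delta> where F: "\<And>n. finite (F n)" "\<And>n. F n \<subseteq> carrier A" "\<And>n. 0 < \<delta> n"
    "\<And>n \<phi>. \<phi> \<in> carrier D \<Longrightarrow> (\<And>a. a \<in> F n \<Longrightarrow> dist (b a \<phi>) 1 < \<delta> n) \<Longrightarrow> dist (\<xi> \<phi>) 1 < inverse (Suc n)"
    by metis
  \<comment> \<open>The identity is added to make \<open>X\<close> nonempty, as its enumeration by
    \<open>from_nat_into\<close> requires.\<close>
  define X where "X = insert \<one>\<^bsub>A\<^esub> (\<Union>n. F n)"
  have X: "countable X" "X \<noteq> {}" "X \<subseteq> carrier A"
    using F(1,2) by (auto simp: X_def countable_finite)
  define e where "e = from_nat_into X"
  have e: "e i \<in> carrier A" for i
    using from_nat_into[OF X(2)] X(3) by (auto simp: e_def)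
  have e_surj: "\<exists>i. e i = a" if "a \<in> X" for a
    using range_from_nat_into[OF X(2,1)] that unfolding e_def by (metis rangeE)
  define r where "r \<phi> = (\<lambda>i. b (e i) \<phi>)" for \<phi>
  have dist_divide: "dist (\<eta> \<phi>) (\<eta> \<psi>) = dist (\<eta> (\<phi> \<otimes>\<^bsub>D\<^esub> inv\<^bsub>D\<^esub> \<psi>)) 1"
    if "\<eta> \<in> hom D circle_group" "\<phi> \<in> carrier D" "\<psi> \<in> carrier D" for \<eta> \<phi> \<psi>
  proof -
    have n: "cmod (\<eta> \<psi>) = 1" using D.character_norm that by blast
    then have "\<eta> \<psi> \<noteq> 0" by auto
    have "\<eta> (\<phi> \<otimes>\<^bsub>D\<^esub> inv\<^bsub>D\<^esub> \<psi>) - 1 = (\<eta> \<phi> - \<eta> \<psi>) * inverse (\<eta> \<psi>)"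
      using that \<open>\<eta> \<psi> \<noteq> 0\<close> by (simp add: D.character_mult D.character_inv field_simps)
    then show ?thesis using n by (simp add: dist_norm norm_mult norm_inverse)
  qed
  \<comment> \<open>Division spreads continuity at the identity over the whole group:
    \<open>\<xi>\<close> is uniformly continuous in the coordinates of \<open>r\<close>. In
    particular it is constant on the fibres of \<open>r\<close>, which may be large, and so factors
    through \<open>r\<close>.\<close>
  have close: "\<exists>J \<delta>. finite J \<and> 0 < \<delta> \<and> (\<forall>\<phi>\<in>carrier D. \<forall>\<psi>\<in>carrier D.
      (\<forall>i\<in>J. dist (r \<phi> i) (r \<psi> i) < \<delta>) \<longrightarrow> dist (\<xi> \<phi>) (\<xi> \<psi>) < \<epsilon>)" if \<epsilon>: "0 < \<epsilon>" for \<epsilon>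
  proof -
    obtain n where n: "inverse (real (Suc n)) < \<epsilon>" using reals_Archimedean[OF \<epsilon>] by blast
    have "\<forall>a\<in>F n. \<exists>i. e i = a" using e_surj by (auto simp: X_def)
    then obtain ix where ix: "\<And>a. a \<in> F n \<Longrightarrow> e (ix a) = a" by metis
    show ?thesis
    proof (intro exI[of _ "ix ` F n"] exI[of _ "\<delta> n"] conjI ballI impI)
      fix \<phi> \<psi> assume *: "\<phi> \<in> carrier D" "\<psi> \<in> carrier D" "\<forall>i\<in>ix ` F n. dist (r \<phi> i) (r \<psi> i) < \<delta> n"
      have "dist (\<xi> (\<phi> \<otimes>\<^bsub>D\<^esub> inv\<^bsub>D\<^esub> \<psi>)) 1 < inverse (Suc n)"
      proof (rule F(4))
        show "\<phi> \<otimes>\<^bsub>D\<^esub> inv\<^bsub>D\<^esub> \<psi> \<in> carrier D" using * by simp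
        fix a assume a: "a \<in> F n"
        then have "dist (b a \<phi>) (b a \<psi>) < \<delta> n" using *(3) ix[OF a] by (auto simp: r_def)
        moreover have "a \<in> carrier A" using a F(2) by blast
        ultimately show "dist (b a (\<phi> \<otimes>\<^bsub>D\<^esub> inv\<^bsub>D\<^esub> \<psi>)) 1 < \<delta> n"
          using dist_divide[OF left *(1,2), of a] by simp
      qed
      then show "dist (\<xi> \<phi>) (\<xi> \<psi>) < \<epsilon>" using dist_divide[OF \<xi> *(1,2)] n by simp
    qed (use F in auto)
  qed
  let ?S = "r ` carrier D" and ?Q = "{s :: nat \<Rightarrow> complex. \<forall>i. s i \<in> sphere 0 1}"
  have "compactin (product_topology (\<lambda>i::nat. euclidean :: complex topology) UNIV) (PiE UNIV (\<lambda>_. sphere 0 1))"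
    by (simp add: compactin_PiE)
  moreover have "?Q = PiE UNIV (\<lambda>_. sphere 0 1)" by (auto simp: PiE_UNIV_domain)
  ultimately have Q: "compact ?Q"
    by (simp add: euclidean_product_topology)
  have "?S \<subseteq> ?Q" using D.character_norm[OF left[OF e]] by (auto simp: r_def)
  then have "closure ?S \<subseteq> ?Q" using closure_minimal[OF _ compact_imp_closed[OF Q]] by blast
  then have C: "compact (closure ?S)" using Q by (metis closed_closure compact_Int_closed inf.absorb_iff2)
  have coord: "\<exists>d>0. \<forall>s\<in>?S. \<forall>t\<in>?S. dist s t < d \<longrightarrow> dist (s i) (t i) < \<epsilon>" if \<epsilon>: "0 < \<epsilon>" for \<epsilon> and i :: nat
  proof -
    have "uniformly_continuous_on (closure ?S) (\<lambda>s. s i)"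
      using C by (intro compact_uniformly_continuous continuous_on_subset[OF continuous_on_product_coordinates]) auto
    then obtain d where d: "d > 0"
      "\<And>s t. s \<in> closure ?S \<Longrightarrow> t \<in> closure ?S \<Longrightarrow> dist t s < d \<Longrightarrow> dist (t i) (s i) < \<epsilon>"
      using uniformly_continuous_onE[of "closure ?S" "\<lambda>s. s i", OF _ \<epsilon>] by metis
    show ?thesis
    proof (intro exI[of _ d] conjI d(1) ballI impI)
      fix s t assume "s \<in> ?S" "t \<in> ?S" "dist s t < d"
      then show "dist (s i) (t i) < \<epsilon>" using d(2)[of t s] closure_subset[of ?S] by (simp add: subset_iff)
    qed
  qed
  define g where "g s = \<xi> (inv_into (carrier D) r s)" for s
  have g: "uniformly_continuous_on ?S g" and gr: "\<And>\<phi>. \<phi> \<in> carrier D \<Longrightarrow> g (r \<phi>) = \<xi> \<phi>"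
  proof -
    show gr: "g (r \<phi>) = \<xi> \<phi>" if \<phi>: "\<phi> \<in> carrier D" for \<phi>
    proof -
      let ?\<psi> = "inv_into (carrier D) r (r \<phi>)"
      have \<psi>: "?\<psi> \<in> carrier D" "r ?\<psi> = r \<phi>"
        using \<phi> by (auto intro: inv_into_into f_inv_into_f)
      have "dist (\<xi> ?\<psi>) (\<xi> \<phi>) < \<epsilon>" if \<epsilon>: "0 < \<epsilon>" for \<epsilon>
      proof -
        obtain J \<delta> where "0 < \<delta>" "\<forall>\<phi>\<in>carrier D. \<forall>\<psi>\<in>carrier D.
          (\<forall>i\<in>J. dist (r \<phi> i) (r \<psi> i) < \<delta>) \<longrightarrow> dist (\<xi> \<phi>) (\<xi> \<psi>) < \<epsilon>"
          using close[OF \<epsilon>] by blast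
        then show ?thesis using \<psi> \<phi> by simp
      qed
      then have "dist (\<xi> ?\<psi>) (\<xi> \<phi>) \<le> 0" by (meson linorder_not_le less_irrefl)
      then show ?thesis by (simp add: g_def)
    qed
    show "uniformly_continuous_on ?S g"
      unfolding uniformly_continuous_on_def
    proof (intro allI impI)
      fix \<epsilon> :: real assume "0 < \<epsilon>"
      then obtain J \<delta> where J: "finite J" "0 < \<delta>" "\<And>\<phi> \<psi>. \<phi> \<in> carrier D \<Longrightarrow> \<psi> \<in> carrier D \<Longrightarrow>
          (\<forall>i\<in>J. dist (r \<phi> i) (r \<psi> i) < \<delta>) \<Longrightarrow> dist (\<xi> \<phi>) (\<xi> \<psi>) < \<epsilon>"
        using close[of \<epsilon>] by blast
      have "\<forall>i. \<exists>d>0. \<forall>s\<in>?S. \<forall>t\<in>?S. dist s t < d \<longrightarrow> dist (s i) (t i) < \<delta>"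
        using coord[OF J(2)] by blast
      then obtain d where d: "\<And>i. 0 < d i" "\<And>i s t. s \<in> ?S \<Longrightarrow> t \<in> ?S \<Longrightarrow> dist s t < d i \<Longrightarrow> dist (s i) (t i) < \<delta>"
        by metis
      define d0 where "d0 = Min (insert 1 (d ` J))"
      have d0: "0 < d0" "\<And>i. i \<in> J \<Longrightarrow> d0 \<le> d i"
        using J(1) d(1) by (auto simp: d0_def)
      show "\<exists>d>0. \<forall>s\<in>?S. \<forall>t\<in>?S. dist t s < d \<longrightarrow> dist (g t) (g s) < \<epsilon>"
      proof (intro exI[of _ d0] conjI ballI impI d0(1))
        fix s t assume st: "s \<in> ?S" "t \<in> ?S" "dist t s < d0"
        then obtain \<phi> \<psi> where *: "\<phi> \<in> carrier D" "s = r \<phi>" "\<psi> \<in> carrier D" "t = r \<psi>" by blast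
        have "\<forall>i\<in>J. dist (t i) (s i) < \<delta>" using d(2)[OF st(2,1)] d0(2) st(3) by force
        then show "dist (g t) (g s) < \<epsilon>" using J(3)[OF *(3,1)] * gr by simp
      qed
    qed
  qed
  obtain h where h: "uniformly_continuous_on (closure ?S) h" "\<And>s. s \<in> ?S \<Longrightarrow> g s = h s"
    using uniformly_continuous_on_extension_on_closure[OF g] by metis
  have hcont: "continuous_on (closure ?S) h" using h(1) by (rule uniformly_continuous_imp_continuous)
  have hr: "h (r \<phi>) = \<xi> \<phi>" if "\<phi> \<in> carrier D" for \<phi> using gr[OF that] h(2) that by force
  define trig where "trig f l \<longleftrightarrow> snd ` set l \<subseteq> carrier A \<and>
    (\<forall>\<phi>\<in>carrier D. f \<phi> = (\<Sum>p\<leftarrow>l. fst p * b (snd p) \<phi>))" for f :: "'d \<Rightarrow> complex" and l :: "(complex \<times> 'a) list"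
  \<comment> \<open>Being a trigonometric sum is demanded only on the image of \<open>r\<close>; on
    the rest of the closure continuity suffices. The functions are real because
    \<open>function_ring_on\<close> provides the real Stone-Weierstrass theorem.\<close>
  define R where "R = {f :: (nat \<Rightarrow> complex) \<Rightarrow> real. continuous_on (closure ?S) f \<and>
     (\<exists>l. trig (\<lambda>\<phi>. of_real (f (r \<phi>))) l)}"
  have b_one: "b \<one>\<^bsub>A\<^esub> \<phi> = 1" if "\<phi> \<in> carrier D" for \<phi>
    using A.character_one[OF right[OF that]] .
  have b_inv: "b (inv\<^bsub>A\<^esub> a) \<phi> = cnj (b a \<phi>)" if "\<phi> \<in> carrier D" "a \<in> carrier A" for a \<phi>
  proof -
    have "b (inv\<^bsub>A\<^esub> a) \<phi> = inverse (b a \<phi>)" using A.character_inv[OF right[OF that(1)] that(2)] .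
    also have "\<dots> = cnj (b a \<phi>)"
      using D.character_norm[OF left[OF that(2)] that(1)] by (simp add: mult_cnj_unit inverse_unique)
    finally show ?thesis .
  qed
  interpret R: function_ring_on R "closure ?S"
  proof
    show "compact (closure ?S)" by (rule C)
    show "continuous_on (closure ?S) f" if "f \<in> R" for f using that by (simp add: R_def)
    show "(\<lambda>x. f x + f' x) \<in> R" if ff: "f \<in> R" "f' \<in> R" for f f'
    proof -
      obtain l l' where "trig (\<lambda>\<phi>. of_real (f (r \<phi>))) l" "trig (\<lambda>\<phi>. of_real (f' (r \<phi>))) l'"
        using ff by (auto simp: R_def)
      then have "trig (\<lambda>\<phi>. of_real (f (r \<phi>) + f' (r \<phi>))) (l @ l')"
        by (auto simp: trig_def)
      then show ?thesis using ff by (auto simp: R_def intro!: continuous_on_add)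
    qed
    show "(\<lambda>x. f x * f' x) \<in> R" if ff: "f \<in> R" "f' \<in> R" for f f'
    proof -
      obtain l l' where l: "trig (\<lambda>\<phi>. of_real (f (r \<phi>))) l" "trig (\<lambda>\<phi>. of_real (f' (r \<phi>))) l'"
        using ff by (auto simp: R_def)
      have sub: "snd ` set l \<subseteq> carrier A" "snd ` set l' \<subseteq> carrier A" using l by (simp_all add: trig_def)
      have mult: "\<forall>a\<in>carrier A. \<forall>a'\<in>carrier A. a \<otimes>\<^bsub>A\<^esub> a' \<in> carrier A \<and>
          (\<forall>\<phi>\<in>carrier D. b (a \<otimes>\<^bsub>A\<^esub> a') \<phi> = b a \<phi> * b a' \<phi>)"
        using A.character_mult[OF right] by simp
      obtain l'' where "snd ` set l'' \<subseteq> carrier A"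
        "\<And>\<phi>. \<phi> \<in> carrier D \<Longrightarrow> (\<Sum>p\<leftarrow>l''. fst p * b (snd p) \<phi>) =
           (\<Sum>p\<leftarrow>l. fst p * b (snd p) \<phi>) * (\<Sum>p\<leftarrow>l'. fst p * b (snd p) \<phi>)"
        by (rule trigonometric_sum_mult[OF mult sub]) (rule that)
      then have "trig (\<lambda>\<phi>. of_real (f (r \<phi>) * f' (r \<phi>))) l''"
        using l by (simp add: trig_def)
      then show ?thesis using ff by (auto simp: R_def intro!: continuous_on_mult)
    qed
    show "(\<lambda>_. c) \<in> R" for c
    proof -
      have "trig (\<lambda>\<phi>. of_real c) [(of_real c, \<one>\<^bsub>A\<^esub>)]"
        using b_one by (simp add: trig_def)
      then show ?thesis by (auto simp: R_def)
    qed
    show "\<exists>f\<in>R. f s \<noteq> f t" if st: "s \<noteq> t" for s t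
    proof -
      obtain i where i: "s i \<noteq> t i" using st by (auto simp: fun_eq_iff)
      have cont_i: "continuous_on (closure ?S) (\<lambda>s. s i)"
        by (rule continuous_on_subset[OF continuous_on_product_coordinates]) simp
      \<comment> \<open>Inversion in \<open>A\<close> is conjugation of values, so the real and
        imaginary parts of a coordinate are combinations of two frequencies.\<close>
      have "trig (\<lambda>\<phi>. of_real (Re (r \<phi> i))) [(1/2, e i), (1/2, inv\<^bsub>A\<^esub> (e i))]"
        using e[of i] b_inv[OF _ e] by (simp add: trig_def r_def complex_eq_iff)
      then have Re: "(\<lambda>s. Re (s i)) \<in> R"
        using cont_i by (auto simp: R_def intro!: continuous_on_Re)
      have "trig (\<lambda>\<phi>. of_real (Im (r \<phi> i))) [(- \<i> / 2, e i), (\<i> / 2, inv\<^bsub>A\<^esub> (e i))]"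
        using e[of i] b_inv[OF _ e] by (simp add: trig_def r_def complex_eq_iff)
      then have Im: "(\<lambda>s. Im (s i)) \<in> R"
        using cont_i by (auto simp: R_def intro!: continuous_on_Im)
      show ?thesis
        using i Re Im by (metis complex_eqI)
    qed
  qed
  \<comment> \<open>An error of 1/4 in each of the two parts keeps the total at 1/2, below the
    critical distance 1.\<close>
  obtain f1 where f1: "f1 \<in> R" "\<And>s. s \<in> closure ?S \<Longrightarrow> \<bar>Re (h s) - f1 s\<bar> < 1/4"
    using R.Stone_Weierstrass_basic[of "\<lambda>s. Re (h s)" "1/4"] hcont by (auto intro: continuous_on_Re)
  obtain f2 where f2: "f2 \<in> R" "\<And>s. s \<in> closure ?S \<Longrightarrow> \<bar>Im (h s) - f2 s\<bar> < 1/4"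
    using R.Stone_Weierstrass_basic[of "\<lambda>s. Im (h s)" "1/4"] hcont by (auto intro: continuous_on_Im)
  obtain l1 l2 where l1: "trig (\<lambda>\<phi>. of_real (f1 (r \<phi>))) l1" and l2: "trig (\<lambda>\<phi>. of_real (f2 (r \<phi>))) l2"
    using f1(1) f2(1) by (auto simp: R_def)
  define l where "l = l1 @ map (\<lambda>p. (\<i> * fst p, snd p)) l2"
  have lA: "snd ` set l \<subseteq> carrier A" using l1 l2 by (auto simp: trig_def l_def)
  have approx: "cmod (\<xi> \<phi> - (\<Sum>p\<leftarrow>l. fst p * b (snd p) \<phi>)) \<le> 1/2" if \<phi>: "\<phi> \<in> carrier D" for \<phi>
  proof -
    have "(\<Sum>p\<leftarrow>l. fst p * b (snd p) \<phi>) = of_real (f1 (r \<phi>)) + \<i> * of_real (f2 (r \<phi>))"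
      using l1 l2 \<phi> by (simp add: l_def trig_def o_def mult.assoc sum_list_const_mult)
    then have "\<xi> \<phi> - (\<Sum>p\<leftarrow>l. fst p * b (snd p) \<phi>) =
        Complex (Re (h (r \<phi>)) - f1 (r \<phi>)) (Im (h (r \<phi>)) - f2 (r \<phi>))"
      using hr[OF \<phi>] by (simp add: complex_eq_iff)
    then have "cmod (\<xi> \<phi> - (\<Sum>p\<leftarrow>l. fst p * b (snd p) \<phi>)) \<le>
        \<bar>Re (h (r \<phi>)) - f1 (r \<phi>)\<bar> + \<bar>Im (h (r \<phi>)) - f2 (r \<phi>)\<bar>"
      using cmod_le[of "Complex (Re (h (r \<phi>)) - f1 (r \<phi>)) (Im (h (r \<phi>)) - f2 (r \<phi>))"] by simp
    moreover have "r \<phi> \<in> closure ?S" by (rule subsetD[OF closure_subset]) (rule imageI[OF \<phi>])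
    ultimately show ?thesis using f1(2)[of "r \<phi>"] f2(2)[of "r \<phi>"] by linarith
  qed
  \<comment> \<open>Otherwise multiplying by \<open>cnj (\<xi> \<phi>)\<close> turns the
    approximation of \<open>\<xi>\<close> into one of the constant 1 by nontrivial characters, with
    error 1/2.\<close>
  have "\<exists>a\<in>snd ` set l. \<forall>\<phi>\<in>carrier D. b a \<phi> * cnj (\<xi> \<phi>) = 1"
  proof (rule ccontr)
    assume *: "\<not> ?thesis"
    let ?l = "map (\<lambda>p. (fst p, \<lambda>\<phi>. b (snd p) \<phi> * cnj (\<xi> \<phi>))) l"
    have "1 \<le> (1/2 :: real)"
    proof (rule D.nontrivial_characters_far_from_one)
      fix q assume "q \<in> set ?l"
      then obtain p where p: "p \<in> set l" "q = (fst p, \<lambda>\<phi>. b (snd p) \<phi> * cnj (\<xi> \<phi>))" by auto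
      then have "b (snd p) \<in> hom D circle_group" using lA left by auto
      then have "(\<lambda>\<phi>. b (snd p) \<phi> * cnj (\<xi> \<phi>)) \<in> hom D circle_group"
        using \<xi> by (auto simp: hom_def Pi_def norm_mult)
      then show "snd q \<in> hom D circle_group \<and> (\<exists>g\<in>carrier D. snd q g \<noteq> 1)"
        using * p by auto
    next
      fix \<phi> assume \<phi>: "\<phi> \<in> carrier D"
      have 1: "\<xi> \<phi> * cnj (\<xi> \<phi>) = 1"
        using D.character_norm[OF \<xi> \<phi>] by (rule mult_cnj_unit)
      have "(\<Sum>p\<leftarrow>?l. fst p * snd p \<phi>) = (\<Sum>p\<leftarrow>l. fst p * b (snd p) \<phi>) * cnj (\<xi> \<phi>)"
        by (simp add: o_def mult.assoc[symmetric] sum_list_mult_const)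
      then have "1 - (\<Sum>p\<leftarrow>?l. fst p * snd p \<phi>) = (\<xi> \<phi> - (\<Sum>p\<leftarrow>l. fst p * b (snd p) \<phi>)) * cnj (\<xi> \<phi>)"
        using 1 by (simp add: algebra_simps)
      then show "cmod (1 - (\<Sum>p\<leftarrow>?l. fst p * snd p \<phi>)) \<le> 1/2"
        using approx[OF \<phi>] D.character_norm[OF \<xi> \<phi>] by (simp add: norm_mult)
    qed
    then show False by simp
  qed
  then obtain a where a: "a \<in> carrier A" "\<And>\<phi>. \<phi> \<in> carrier D \<Longrightarrow> b a \<phi> * cnj (\<xi> \<phi>) = 1"
    using lA by blast
  show thesis
  proof (rule that[OF a(1)])
    fix \<phi> assume \<phi>: "\<phi> \<in> carrier D"
    have "\<xi> \<phi> * cnj (\<xi> \<phi>) = 1"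
      using D.character_norm[OF \<xi> \<phi>] by (rule mult_cnj_unit)
    then show "\<xi> \<phi> = b a \<phi>"
      using a(2)[OF \<phi>] by (metis mult_cancel_right mult_zero_right zero_neq_one)
  qed
qed

section \<open>The dual group of a P-modification\<close>

lemma dual_group_simps [simp]:
  "carrier (dual_group G T) = continuous_characters G T"
  "\<phi> \<otimes>\<^bsub>dual_group G T\<^esub> \<psi> = (\<lambda>x\<in>carrier G. \<phi> x * \<psi> x)"
  "\<one>\<^bsub>dual_group G T\<^esub> = (\<lambda>x\<in>carrier G. 1)"
  by (simp_all add: dual_group_def)

lemma openin_dual_topology_eval:
  assumes "x \<in> topspace T"
  shows "openin (dual_topology G T) {\<phi> \<in> continuous_characters G T. dist (\<phi> x) c < \<epsilon>}"
  unfolding openin_dual_topology dual_open_def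
proof (intro conjI ballI)
  fix \<phi> assume \<phi>: "\<phi> \<in> {\<phi> \<in> continuous_characters G T. dist (\<phi> x) c < \<epsilon>}"
  have "{\<psi> \<in> continuous_characters G T. \<forall>y\<in>{x}. dist (\<psi> y) (\<phi> y) < \<epsilon> - dist (\<phi> x) c} \<subseteq>
      {\<phi> \<in> continuous_characters G T. dist (\<phi> x) c < \<epsilon>}"
  proof
    fix \<psi> assume "\<psi> \<in> {\<psi> \<in> continuous_characters G T. \<forall>y\<in>{x}. dist (\<psi> y) (\<phi> y) < \<epsilon> - dist (\<phi> x) c}"
    then show "\<psi> \<in> {\<phi> \<in> continuous_characters G T. dist (\<phi> x) c < \<epsilon>}"
      using dist_triangle[of "\<psi> x" c "\<phi> x"] by simp
  qed
  moreover have "0 < \<epsilon> - dist (\<phi> x) c" using \<phi> by simp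
  ultimately show "\<exists>K \<delta>. compactin T K \<and> \<delta> > 0 \<and>
      {\<psi> \<in> continuous_characters G T. \<forall>x\<in>K. dist (\<psi> x) (\<phi> x) < \<delta>} \<subseteq>
      {\<phi> \<in> continuous_characters G T. dist (\<phi> x) c < \<epsilon>}"
    using assms by (intro exI[of _ "{x}"] exI[of _ "\<epsilon> - dist (\<phi> x) c"] conjI) simp_all
qed simp

lemma topspace_circle_topology [simp]: "topspace circle_topology = sphere 0 1"
  by (simp add: circle_topology_def)

context topological_abelian_group
begin

abbreviation PT :: "'a topology" where
  "PT \<equiv> P_modification T"

abbreviation P_characters :: "('a \<Rightarrow> complex) set" where
  "P_characters \<equiv> continuous_characters G PT"

lemma topspace_PT: "topspace PT = carrier G"
  by (simp add: topspace_eq_carrier)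

lemma P_characterD:
  assumes "\<phi> \<in> P_characters"
  shows "\<phi> \<in> hom G circle_group" "\<phi> \<in> extensional (carrier G)"
  using assms by (simp_all add: continuous_characters_def)

lemma gdelta_subgroup_mem:
  assumes "gdelta_subgroup N"
  shows "\<one> \<in> N" "x \<in> N \<Longrightarrow> x \<in> carrier G"
  using subgroup.one_closed subgroup.subset gdelta_subgroup_imp_subgroup[OF assms] by blast+

text \<open>The point 1 is a G_delta in the circle, as the intersection of the balls of radius
  \<open>inverse (Suc n)\<close>, so the kernel of a continuous character is P-open.\<close>

lemma P_character_trivial:
  assumes \<phi>: "\<phi> \<in> P_characters"
  obtains N where "gdelta_subgroup N" "\<And>x. x \<in> N \<Longrightarrow> \<phi> x = 1"
proof -
  have cont: "continuous_map PT circle_topology \<phi>"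
    using \<phi> by (simp add: continuous_characters_def)
  let ?U = "\<lambda>n::nat. {x \<in> topspace PT. \<phi> x \<in> sphere 0 1 \<inter> ball 1 (inverse (Suc n))}"
  have "openin PT (?U n)" for n
    by (rule openin_continuous_map_preimage[OF cont]) (simp add: circle_topology_def openin_open_Int)
  then have "openin PT (\<Inter>n. ?U n)" by (rule openin_P_modification_INT_nat)
  moreover have "\<one> \<in> (\<Inter>n. ?U n)"
    using character_one[OF P_characterD(1)[OF \<phi>]] by (simp add: topspace_eq_carrier)
  ultimately obtain N where N: "gdelta_subgroup N" "N \<subseteq> (\<Inter>n. ?U n)"
    by (rule gdelta_subgroup_subset)
  have "\<phi> x = 1" if "x \<in> N" for x
  proof (rule ccontr)
    assume "\<phi> x \<noteq> 1"
    then obtain n where n: "inverse (real (Suc n)) < dist 1 (\<phi> x)"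
      using reals_Archimedean[of "dist 1 (\<phi> x)"] by auto
    have "x \<in> ?U n" using that N(2) by blast
    then show False using n by simp
  qed
  then show thesis using N(1) that by blast
qed

text \<open>The preimage of any set whatsoever, open or not, is a union of cosets of
  \<open>N\<close>.\<close>

lemma P_characterI:
  assumes \<phi>: "\<phi> \<in> hom G circle_group" "\<phi> \<in> extensional (carrier G)"
    and N: "gdelta_subgroup N" "\<And>x. x \<in> N \<Longrightarrow> \<phi> x = 1"
  shows "\<phi> \<in> P_characters"
proof -
  have "continuous_map PT circle_topology \<phi>"
    unfolding continuous_map_def
  proof (intro conjI allI impI)
    show "\<phi> \<in> topspace PT \<rightarrow> topspace circle_topology"
      using character_norm[OF \<phi>(1)] by (auto simp: topspace_eq_carrier)
    fix U
    show "openin PT {x \<in> topspace PT. \<phi> x \<in> U}"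
      unfolding openin_P_modification_group topspace_PT
    proof (intro conjI ballI)
      fix x assume "x \<in> {x \<in> carrier G. \<phi> x \<in> U}"
      then have "\<forall>n\<in>N. x \<otimes> n \<in> {x \<in> carrier G. \<phi> x \<in> U}"
        using N(2) character_mult[OF \<phi>(1)] gdelta_subgroup_mem(2)[OF N(1)] by simp
      then show "\<exists>N. gdelta_subgroup N \<and> (\<forall>n\<in>N. x \<otimes> n \<in> {x \<in> carrier G. \<phi> x \<in> U})"
        using N(1) by blast
    qed simp
  qed
  then show ?thesis using \<phi> by (simp add: continuous_characters_def)
qed

lemma P_characterI_restrict:
  assumes "f \<in> hom G circle_group" "gdelta_subgroup N" "\<And>x. x \<in> N \<Longrightarrow> f x = 1"
  shows "restrict f (carrier G) \<in> P_characters"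
proof (rule P_characterI)
  show "restrict f (carrier G) \<in> hom G circle_group"
    using assms(1) by (simp add: hom_def Pi_def)
  show "restrict f (carrier G) x = 1" if "x \<in> N" for x
    using that assms(3) gdelta_subgroup_mem(2)[OF assms(2)] by simp
qed (use assms(2) in auto)

lemma P_character_mult:
  assumes "\<phi> \<in> P_characters" "\<psi> \<in> P_characters"
  shows "(\<lambda>x\<in>carrier G. \<phi> x * \<psi> x) \<in> P_characters"
proof -
  obtain N where N: "gdelta_subgroup N" "\<And>x. x \<in> N \<Longrightarrow> \<phi> x = 1"
    using P_character_trivial[OF assms(1)] by metis
  obtain N' where N': "gdelta_subgroup N'" "\<And>x. x \<in> N' \<Longrightarrow> \<psi> x = 1"
    using P_character_trivial[OF assms(2)] by metis
  have "openin PT (N \<inter> N')" "\<one> \<in> N \<inter> N'"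
    using N N' gdelta_subgroup_openin gdelta_subgroup_mem by auto
  then obtain M where M: "gdelta_subgroup M" "M \<subseteq> N \<inter> N'" by (rule gdelta_subgroup_subset)
  show ?thesis
  proof (rule P_characterI_restrict[OF _ M(1)])
    show "(\<lambda>x. \<phi> x * \<psi> x) \<in> hom G circle_group"
      using P_characterD(1)[OF assms(1)] P_characterD(1)[OF assms(2)] by (simp add: hom_def Pi_def norm_mult)
    show "\<phi> x * \<psi> x = 1" if "x \<in> M" for x
    proof -
      have "x \<in> N" "x \<in> N'" using that M(2) by auto
      then show ?thesis using N(2) N'(2) by simp
    qed
  qed
qed

lemma P_character_inverse:
  assumes "\<phi> \<in> P_characters"
  shows "(\<lambda>x\<in>carrier G. inverse (\<phi> x)) \<in> P_characters"
proof -
  obtain N where N: "gdelta_subgroup N" "\<And>x. x \<in> N \<Longrightarrow> \<phi> x = 1"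
    using P_character_trivial[OF assms] by metis
  show ?thesis
  proof (rule P_characterI_restrict[OF _ N(1)])
    show "(\<lambda>x. inverse (\<phi> x)) \<in> hom G circle_group"
      using P_characterD(1)[OF assms] by (simp add: hom_def Pi_def norm_inverse)
  qed (simp add: N(2))
qed

lemma P_character_one: "(\<lambda>x\<in>carrier G. 1) \<in> P_characters"
proof -
  have "openin PT (carrier G)" using openin_topspace[of PT] by (simp add: topspace_eq_carrier)
  then obtain N where "gdelta_subgroup N" using gdelta_subgroup_subset by (metis one_closed)
  then show ?thesis by (intro P_characterI_restrict) (simp_all add: hom_def)
qed

lemma group_dual_P: "group (dual_group G PT)"
proof (rule groupI)
  fix \<phi> assume "\<phi> \<in> carrier (dual_group G PT)"
  then have \<phi>: "\<phi> \<in> P_characters" by simp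
  show "\<exists>\<psi>\<in>carrier (dual_group G PT). \<psi> \<otimes>\<^bsub>dual_group G PT\<^esub> \<phi> = \<one>\<^bsub>dual_group G PT\<^esub>"
  proof (rule bexI)
    have "\<phi> x \<noteq> 0" if "x \<in> carrier G" for x
      using character_norm[OF P_characterD(1)[OF \<phi>] that] by auto
    then show "(\<lambda>x\<in>carrier G. inverse (\<phi> x)) \<otimes>\<^bsub>dual_group G PT\<^esub> \<phi> = \<one>\<^bsub>dual_group G PT\<^esub>"
      by (auto simp: restrict_def fun_eq_iff)
  qed (simp add: P_character_inverse[OF \<phi>])
  show "\<one>\<^bsub>dual_group G PT\<^esub> \<otimes>\<^bsub>dual_group G PT\<^esub> \<phi> = \<phi>"
    using P_characterD(2)[OF \<phi>] by (auto simp: extensional_def fun_eq_iff)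
qed (simp_all add: P_character_mult P_character_one, auto simp: restrict_def fun_eq_iff mult.assoc)

lemma evaluation_hom_circle:
  "a \<in> carrier G \<Longrightarrow> (\<lambda>\<phi>. \<phi> a) \<in> hom (dual_group G PT) circle_group"
  using character_norm[OF P_characterD(1)] by (simp add: hom_def Pi_def)

text \<open>Triviality on \<open>N\<close> already implies continuity, so the annihilator is cut out
  of a product of circles by closed equations alone. Tychonoff's theorem makes it compact for
  pointwise convergence.\<close>

lemma compactin_annihilator:
  assumes N: "gdelta_subgroup N"
  shows "compactin (dual_topology G PT) {\<phi> \<in> P_characters. \<forall>x\<in>N. \<phi> x = 1}"
proof -
  let ?P = "product_topology (\<lambda>_. circle_topology) (carrier G)"
  let ?A = "{\<phi> \<in> P_characters. \<forall>x\<in>N. \<phi> x = 1}"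
  have top: "topspace ?P = (\<Pi>\<^sub>E x\<in>carrier G. sphere 0 1)"
    by simp
  have "compact_space (circle_topology)"
    by (simp add: circle_topology_def compact_space_subtopology)
  then have P: "compact_space ?P" by (simp add: compact_space_product_topology)
  have ev: "continuous_map ?P euclidean (\<lambda>\<phi>. \<phi> x)" if "x \<in> carrier G" for x
    using continuous_map_product_projection[OF that, of "\<lambda>_. circle_topology"]
    by (simp add: circle_topology_def continuous_map_in_subtopology)
  have ev2: "continuous_map ?P euclidean (\<lambda>\<phi>. \<phi> x * \<phi> y)" if "x \<in> carrier G" "y \<in> carrier G" for x y
    using ev[OF that(1)] ev[OF that(2)] by (simp add: continuous_map_atin tendsto_mult)
  have "?A = topspace ?P \<inter> (\<Inter>x\<in>carrier G. \<Inter>y\<in>carrier G. {\<phi> \<in> topspace ?P. \<phi> (x \<otimes> y) = \<phi> x * \<phi> y}) \<inter>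
     (\<Inter>x\<in>N. {\<phi> \<in> topspace ?P. \<phi> x = 1})" (is "_ = ?B")
  proof (intro equalityI subsetI)
    fix \<phi> assume \<phi>: "\<phi> \<in> ?A"
    then have hom: "\<phi> \<in> hom G circle_group" and ext: "\<phi> \<in> extensional (carrier G)"
      using P_characterD by auto
    have "\<phi> \<in> topspace ?P"
      using character_norm[OF hom] ext by (simp add: top PiE_iff)
    then show "\<phi> \<in> ?B" using \<phi> character_mult[OF hom] by simp
  next
    fix \<phi> assume \<phi>: "\<phi> \<in> ?B"
    then have "\<phi> \<in> hom G circle_group" "\<phi> \<in> extensional (carrier G)" "\<forall>x\<in>N. \<phi> x = 1"
      unfolding top by (auto simp: hom_def PiE_iff)
    then show "\<phi> \<in> ?A" using P_characterI[OF _ _ N] by simp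
  qed
  moreover have "closedin ?P {\<phi> \<in> topspace ?P. \<phi> (x \<otimes> y) = \<phi> x * \<phi> y}"
    if "x \<in> carrier G" "y \<in> carrier G" for x y
    using that by (intro closedin_continuous_maps_eq[where Y = euclidean] ev ev2) simp_all
  moreover have "closedin ?P {\<phi> \<in> topspace ?P. \<phi> x = 1}" if "x \<in> N" for x
    using gdelta_subgroup_mem(2)[OF N that]
    by (intro closedin_continuous_maps_eq[where Y = euclidean] ev) simp_all
  moreover have "carrier G \<noteq> {}" "N \<noteq> {}" using gdelta_subgroup_mem(1)[OF N] one_closed by auto
  ultimately have "closedin ?P ?A"
    by (metis (no_types, lifting) closedin_INT closedin_Int closedin_topspace)
  then have sub: "?A \<subseteq> topspace ?P" and cpt: "compactin (subtopology ?P ?A) ?A"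
    using closedin_compact_space[OF P] by (simp_all only: closedin_subset compactin_subtopology subset_refl)
  \<comment> \<open>Compactness passes to the dual topology because a basic neighbourhood there
    tests only a finite set of points.\<close>
  have "continuous_map (subtopology ?P ?A) (dual_topology G PT) id"
    unfolding continuous_map_def
  proof (intro conjI allI impI)
    show "id \<in> topspace (subtopology ?P ?A) \<rightarrow> topspace (dual_topology G PT)" by auto
    fix U assume U: "openin (dual_topology G PT) U"
    have "\<exists>W. openin ?P W \<and> \<phi> \<in> W \<and> W \<inter> ?A \<subseteq> U" if \<phi>: "\<phi> \<in> U \<inter> ?A" for \<phi>
    proof -
      obtain K \<epsilon> where K: "compactin PT K" "\<epsilon> > 0"
        "{\<psi> \<in> P_characters. \<forall>x\<in>K. dist (\<psi> x) (\<phi> x) < \<epsilon>} \<subseteq> U"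
        using U \<phi> unfolding openin_dual_topology dual_open_def by blast
      have fin: "finite K" using compactin_P_modification_imp_finite[OF Hausdorff K(1)] .
      have KG: "K \<subseteq> carrier G" using compactin_subset_topspace[OF K(1)] by (simp add: topspace_eq_carrier)
      let ?W = "(\<Inter>x\<in>K. {\<psi> \<in> topspace ?P. \<psi> x \<in> ball (\<phi> x) \<epsilon>}) \<inter> topspace ?P"
      have "openin ?P {\<psi> \<in> topspace ?P. \<psi> x \<in> ball (\<phi> x) \<epsilon>}" if "x \<in> K" for x
        using that KG by (intro openin_continuous_map_preimage[OF ev]) auto
      then have "openin ?P ?W" by (rule openin_INT[OF fin])
      moreover have "\<phi> \<in> topspace ?P"
        using \<phi> P_characterD character_norm by (simp add: top PiE_iff)
      then have "\<phi> \<in> ?W" using K(2) by simp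
      moreover have "?W \<inter> ?A \<subseteq> U"
      proof
        fix \<psi> assume "\<psi> \<in> ?W \<inter> ?A"
        then have "\<psi> \<in> {\<psi> \<in> P_characters. \<forall>x\<in>K. dist (\<psi> x) (\<phi> x) < \<epsilon>}"
          by (simp add: dist_commute)
        then show "\<psi> \<in> U" using K(3) by blast
      qed
      ultimately show ?thesis by blast
    qed
    then have "openin (subtopology ?P ?A) (U \<inter> ?A)"
      unfolding openin_subopen[of _ "U \<inter> ?A"] openin_subtopology by (metis (no_types, lifting) IntD2 IntI Int_subset_iff inf_le2)
    moreover have "{\<phi> \<in> topspace (subtopology ?P ?A). id \<phi> \<in> U} = U \<inter> ?A"
      using sub by (simp only: topspace_subtopology id_apply) blast
    ultimately show "openin (subtopology ?P ?A) {\<phi> \<in> topspace (subtopology ?P ?A). id \<phi> \<in> U}" by simp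
  qed
  with cpt have "compactin (dual_topology G PT) (id ` ?A)" by (rule image_compactin)
  then show ?thesis by simp
qed

end

section \<open>Compact subsets of the dual\<close>

text \<open>Squaring multiplies the distance from 1 by |w + 1|. A unit \<open>w\<close> at distance
  less than 1 has real part above 1/2, so this factor is at least 3/2 and repeated squaring leaves
  the disc.\<close>

lemma unit_powers_near_one:
  assumes z: "cmod z = 1" and near: "\<And>k::nat. dist (z ^ k) 1 < 1"
  shows "z = 1"
proof (rule ccontr)
  assume "z \<noteq> 1"
  have double: "(3/2) * dist w 1 \<le> dist (w ^ 2) 1" if "dist w 1 < 1" "cmod w = 1" for w
  proof -
    have "dist (w ^ 2) 1 = cmod ((w + 1) * (w - 1))"
      by (simp add: dist_norm power2_eq_square algebra_simps)
    also have "\<dots> = cmod (w + 1) * dist w 1" by (simp add: norm_mult dist_norm)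
    finally have eq: "dist (w ^ 2) 1 = cmod (w + 1) * dist w 1" .
    have "(Re w)\<^sup>2 + (Im w)\<^sup>2 = 1" using that(2) cmod_power2[of w] by simp
    then have "(cmod (w - 1))\<^sup>2 = 2 - 2 * Re w"
      unfolding cmod_power2 by (simp add: power2_eq_square algebra_simps)
    moreover have "(cmod (w - 1))\<^sup>2 < 1"
      using that(1) by (simp add: dist_norm power_less_one_iff abs_square_less_1)
    ultimately have "3/2 \<le> Re (w + 1)" by simp
    then have "3/2 \<le> cmod (w + 1)" using complex_Re_le_cmod order.trans by blast
    then show ?thesis unfolding eq by (rule mult_right_mono) simp
  qed
  have grow: "(3/2) ^ k * dist z 1 \<le> dist (z ^ (2 ^ k)) 1" for k
  proof (induction k)
    case (Suc k)
    have "(3/2) ^ Suc k * dist z 1 \<le> (3/2) * dist (z ^ (2 ^ k)) 1" using Suc by (simp add: mult_ac)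
    also have "\<dots> \<le> dist ((z ^ (2 ^ k)) ^ 2) 1"
      using near z by (intro double) (simp_all add: norm_power)
    finally show ?case by (simp add: power_mult[symmetric] mult.commute)
  qed simp
  obtain k where "1 / dist z 1 < (3/2) ^ k" using real_arch_pow[of "3/2" "1 / dist z 1"] by auto
  then have "1 < (3/2) ^ k * dist z 1" using \<open>z \<noteq> 1\<close> by (simp add: field_simps)
  then show False using grow[of k] near[of "2 ^ k"] by linarith
qed

text \<open>A finite subfamily of a chain has its least member as intersection, which gives the
  finite intersection property. The index set is arbitrary, so towers of uncountable length are
  covered.\<close>

lemma compact_space_closed_chain:
  assumes X: "compact_space X" and J: "J \<noteq> {}" and closed: "\<And>i. i \<in> J \<Longrightarrow> closedin X (S i)"
    and ne: "\<And>i. i \<in> J \<Longrightarrow> S i \<noteq> {}"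
    and chain: "\<And>i j. i \<in> J \<Longrightarrow> j \<in> J \<Longrightarrow> S i \<subseteq> S j \<or> S j \<subseteq> S i"
  shows "(\<Inter>i\<in>J. S i) \<noteq> {}"
proof -
  have "\<Inter>\<F> \<noteq> {}" if \<F>: "finite \<F>" "\<F> \<subseteq> S ` J" for \<F>
  proof (cases "\<F> = {}")
    case False
    have "subset.chain (S ` J) \<F>"
      unfolding subset_chain_def
    proof (intro conjI ballI \<F>(2))
      fix X Y assume "X \<in> \<F>" "Y \<in> \<F>"
      then obtain i j where "i \<in> J" "j \<in> J" "X = S i" "Y = S j" using \<F>(2) by (meson imageE subsetD)
      then show "X \<subseteq> Y \<or> Y \<subseteq> X" using chain by simp
    qed
    then have "\<Inter>\<F> \<in> \<F>" by (rule Inter_in_chain[OF \<F>(1) False])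
    then show ?thesis using \<F>(2) ne by blast
  qed simp
  then show ?thesis
    using X closed unfolding compact_space_fip by (metis (no_types, lifting) imageE)
qed

section \<open>Compactness of the group and triviality on a common subgroup\<close>

context topological_abelian_group
begin

lemma closedin_translate:
  assumes a: "a \<in> carrier G" and S: "closedin T S"
  shows "closedin T {x \<in> carrier G. a \<otimes> x \<in> S}"
  using closedin_continuous_map_preimage[OF continuous_map_translation[OF a] S]
  by (simp add: topspace_eq_carrier)

text \<open>Compactness supplies one \<open>v\<close> for all \<open>n\<close>: the admissible
  \<open>v\<close> for the closures of the \<open>V n\<close> form decreasing nonempty closed sets,
  and passing to closures costs only one index.\<close>

lemma neighbourhood_chain_closure_mult:
  assumes "compact_space T" and V: "neighbourhood_chain V" and B: "closedin T B"
    and y: "y \<in> carrier G" and meet: "\<And>n. \<exists>v\<in>B. y \<otimes> inv v \<in> V n"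
  shows "\<exists>v\<in>B. y \<otimes> inv v \<in> (\<Inter>n. V n)"
proof -
  have cont: "continuous_map T T (\<lambda>v. y \<otimes> inv v)"
    using continuous_map_compose[OF continuous_inv continuous_map_translation[OF y]] by (simp add: o_def)
  define C where "C n = B \<inter> {v \<in> topspace T. y \<otimes> inv v \<in> T closure_of (V n)}" for n
  have "(\<Inter>n. C n) \<noteq> {}"
  proof (rule compact_space_closed_chain[OF assms(1)])
    show "closedin T (C n)" for n
      unfolding C_def using closedin_continuous_map_preimage[OF cont closedin_closure_of]
      by (intro closedin_Int B) auto
    show "C n \<noteq> {}" for n
    proof -
      obtain v where v: "v \<in> B" "y \<otimes> inv v \<in> V n" using meet by blast
      have "V n \<subseteq> T closure_of (V n)"
        using neighbourhood_chainD(3)[OF V] by (intro closure_of_subset) (simp add: topspace_eq_carrier)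
      then have "v \<in> C n" using v closedin_subset[OF B] by (auto simp: C_def)
      then show ?thesis by blast
    qed
    have mono: "C n \<subseteq> C m" if "m \<le> n" for m n
      unfolding C_def using closure_of_mono[OF neighbourhood_chain_antimono[OF V that]] by blast
    show "C i \<subseteq> C j \<or> C j \<subseteq> C i" for i j
      using mono[of i j] mono[of j i] by (cases "i \<le> j") auto
  qed simp
  then obtain v where v: "\<And>n. v \<in> C n" by blast
  have "y \<otimes> inv v \<in> V n" for n
    using v[of "Suc n"] neighbourhood_chain_closure[OF V, of n] by (auto simp: C_def)
  then show ?thesis using v[of 0] by (auto simp: C_def)
qed

text \<open>The powers of a value other than 1 cannot all stay within distance 1 of 1, and the
  powers of \<open>x\<close> remain in \<open>N\<close>.\<close>

lemma character_far_from_one: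
  assumes \<phi>: "\<phi> \<in> hom G circle_group" and N: "subgroup N G" and x: "x \<in> N" "\<phi> x \<noteq> 1"
  obtains y where "y \<in> N" "1 \<le> dist (\<phi> y) 1"
proof -
  have xG: "x \<in> carrier G" using subgroup.subset[OF N] x(1) by blast
  obtain k :: nat where k: "\<not> dist (\<phi> x ^ k) 1 < 1"
    using unit_powers_near_one[OF character_norm[OF \<phi> xG]] x(2) by blast
  have "x [^] k \<in> N" by (induction k) (use N x(1) in \<open>auto intro: subgroup.one_closed subgroup.m_closed\<close>)
  moreover have "1 \<le> dist (\<phi> (x [^] k)) 1" using k character_pow[OF \<phi> xG] by simp
  ultimately show thesis by (rule that)
qed

text \<open>Otherwise one picks, along the first uncountable ordinal, characters \<open>p b \<in> K\<close> that are
  nontrivial on the intersection \<open>B b\<close> of subgroups \<open>M (p c)\<close>, \<open>c < b\<close>, on which the earlier ones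
  are trivial.  A point \<open>\<psi>\<close> all of whose neighbourhoods contain uncountably many \<open>p b\<close> is trivial
  on some \<open>B a\<close>; yet by compactness of \<open>G\<close> there is \<open>h \<in> B a\<close> at which all \<open>p b\<close> with
  \<open>b \<ge> a\<close> are far from \<open>1\<close>.\<close>

lemma compactin_dual_trivial:
  assumes cpt: "compact_space T" and K: "compactin (dual_topology G PT) K"
  shows "\<exists>N. gdelta_subgroup N \<and> (\<forall>\<phi>\<in>K. \<forall>x\<in>N. \<phi> x = 1)"
proof (rule ccontr)
  assume "\<not> ?thesis"
  then have nontriv: "\<exists>\<phi>\<in>K. \<exists>x\<in>N. \<phi> x \<noteq> 1" if "gdelta_subgroup N" for N
    using that by blast
  have KP: "K \<subseteq> P_characters" using compactin_subset_topspace[OF K] by simp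
  have "\<forall>\<phi>\<in>K. \<exists>N. gdelta_subgroup N \<and> (\<forall>x\<in>N. \<phi> x = 1)"
    using P_character_trivial KP by (metis subsetD)
  then obtain M where M: "\<And>\<phi>. \<phi> \<in> K \<Longrightarrow> gdelta_subgroup (M \<phi>)"
    "\<And>\<phi> x. \<phi> \<in> K \<Longrightarrow> x \<in> M \<phi> \<Longrightarrow> \<phi> x = 1"
    by metis
  obtain I :: "nat set set" and R where I: "\<not> countable I" and R: "wf R" "trans R" "total_on I R"
    and below: "\<And>a. countable {b. (b, a) \<in> R}"
    by (rule omega1_exists) (rule that)
  have total: "(x, y) \<in> R \<or> (y, x) \<in> R" if "x \<in> I" "y \<in> I" "x \<noteq> y" for x y
    using R(3) that unfolding total_on_def by simp
  \<comment> \<open>Each index has countably many predecessors, so a G_delta subgroup fits below all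
    their \<open>M\<close>, and by assumption some character in \<open>K\<close> is nontrivial on
    it.\<close>
  have "\<exists>p. \<forall>b. p b \<in> K \<and> (\<exists>x\<in>carrier G. (\<forall>c. (c, b) \<in> R \<longrightarrow> x \<in> M (p c)) \<and> p b x \<noteq> 1)"
  proof (rule dependent_wf_choice[OF R(1)])
    fix f b assume f: "\<And>c. (c, b) \<in> R \<Longrightarrow> f c \<in> K \<and>
      (\<exists>x\<in>carrier G. (\<forall>d. (d, c) \<in> R \<longrightarrow> x \<in> M (f d)) \<and> f c x \<noteq> 1)"
    obtain N where N: "gdelta_subgroup N" "N \<subseteq> (\<Inter>c\<in>{c. (c, b) \<in> R}. M (f c))"
      using gdelta_subgroup_INT[OF below[of b], of "\<lambda>c. M (f c)"] M(1) f by (metis mem_Collect_eq)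
    obtain \<phi> x where "\<phi> \<in> K" "x \<in> N" "\<phi> x \<noteq> 1" using nontriv[OF N(1)] by blast
    then show "\<exists>\<phi>. \<phi> \<in> K \<and> (\<exists>x\<in>carrier G. (\<forall>c. (c, b) \<in> R \<longrightarrow> x \<in> M (f c)) \<and> \<phi> x \<noteq> 1)"
      using N gdelta_subgroup_mem(2)[OF N(1)] by (intro exI[of _ \<phi>] conjI bexI[of _ x]) auto
  qed simp
  then obtain p where pK: "\<And>b. p b \<in> K"
    and p: "\<And>b. \<exists>x\<in>carrier G. (\<forall>c. (c, b) \<in> R \<longrightarrow> x \<in> M (p c)) \<and> p b x \<noteq> 1"
    by metis
  have p_hom: "p b \<in> hom G circle_group" for b using P_characterD(1) KP pK by blast
  define B where "B b = {x \<in> carrier G. \<forall>c. (c, b) \<in> R \<longrightarrow> x \<in> M (p c)}" for b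
  \<comment> \<open>\<open>B b\<close> imposes the strict predecessors only and \<open>B' b\<close>
    also \<open>b\<close> itself: \<open>p b\<close> is nontrivial on the former and trivial on the
    latter.\<close>
  define B' where "B' b = B b \<inter> M (p b)" for b
  have B_eq: "B b = carrier G \<inter> \<Inter> ((\<lambda>c. M (p c)) ` {c. (c, b) \<in> R})" for b
    by (auto simp: B_def)
  have M_sub: "subgroup (M (p b)) G" and M_closed: "closedin T (M (p b))" for b
    using M(1)[OF pK] gdelta_subgroup_imp_subgroup gdelta_subgroup_closedin by blast+
  have B_sub: "subgroup (B b) G" for b
  proof (rule subgroupI)
    show "B b \<subseteq> carrier G" by (auto simp: B_def)
    show "B b \<noteq> {}" using subgroup.one_closed[OF M_sub] by (auto simp: B_def intro!: exI[of _ \<one>])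
    show "inv x \<in> B b" if "x \<in> B b" for x
      using that subgroup.m_inv_closed[OF M_sub] by (simp add: B_def)
    show "x \<otimes> y \<in> B b" if "x \<in> B b" "y \<in> B b" for x y
      using that subgroup.m_closed[OF M_sub] by (simp add: B_def)
  qed
  have B'_sub: "subgroup (B' b) G" for b
    unfolding B'_def by (rule subgroups_Inter_pair[OF B_sub M_sub])
  have B_closed: "closedin T (B b)" for b
  proof (cases "{c. (c, b) \<in> R} = {}")
    case True
    then show ?thesis using closedin_topspace[of T] by (simp add: B_eq topspace_eq_carrier)
  next
    case False
    then show ?thesis unfolding B_eq topspace_eq_carrier[symmetric]
      by (intro closedin_Int closedin_topspace closedin_INT) (auto intro: M_closed)
  qed
  have B'_closed: "closedin T (B' b)" for b
    unfolding B'_def by (intro closedin_Int B_closed M_closed)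
  have B_mono: "B b \<subseteq> B' c" if "(c, b) \<in> R" for b c
    using that transD[OF R(2)] by (auto simp: B_def B'_def)
  have B'_le: "B' b \<subseteq> B b" for b by (simp add: B'_def)
  have triv: "p b x = 1" if "x \<in> B' b" for b x using that M(2)[OF pK] by (simp add: B'_def)
  have upper: "\<exists>a\<in>I. \<forall>c\<in>C. (c, a) \<in> R" if C: "countable C" "C \<subseteq> I" for C
  proof -
    have "countable (C \<union> (\<Union>c\<in>C. {b. (b, c) \<in> R}))" using C(1) below by (intro countable_Un countable_UN)
    then obtain a where a: "a \<in> I" "a \<notin> C \<union> (\<Union>c\<in>C. {b. (b, c) \<in> R})"
      using I by (meson countable_subset subsetI)
    have "(c, a) \<in> R" if "c \<in> C" for c
    proof -
      have "c \<in> I" "c \<noteq> a" "(a, c) \<notin> R" using that a C(2) by auto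
      then show ?thesis using total[of c a] a(1) by simp
    qed
    then show ?thesis using a(1) by blast
  qed
  \<comment> \<open>Otherwise finitely many open sets, each catching countably many indices, would
    cover \<open>K\<close> and make \<open>I\<close> countable. Counting indices and not characters
    avoids any appeal to injectivity of \<open>p\<close>.\<close>
  obtain \<psi> where \<psi>: "\<psi> \<in> K"
    and accum: "\<And>U. openin (dual_topology G PT) U \<Longrightarrow> \<psi> \<in> U \<Longrightarrow> \<not> countable {b \<in> I. p b \<in> U}"
  proof -
    have "\<exists>\<psi>\<in>K. \<forall>U. openin (dual_topology G PT) U \<longrightarrow> \<psi> \<in> U \<longrightarrow> \<not> countable {b \<in> I. p b \<in> U}"
    proof (rule ccontr)
      assume "\<not> ?thesis"
      then have "\<forall>\<psi>\<in>K. \<exists>U. openin (dual_topology G PT) U \<and> \<psi> \<in> U \<and> countable {b \<in> I. p b \<in> U}"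
        by blast
      then obtain U where U: "\<And>\<psi>. \<psi> \<in> K \<Longrightarrow> openin (dual_topology G PT) (U \<psi>)"
        "\<And>\<psi>. \<psi> \<in> K \<Longrightarrow> \<psi> \<in> U \<psi>" "\<And>\<psi>. \<psi> \<in> K \<Longrightarrow> countable {b \<in> I. p b \<in> U \<psi>}"
        by metis
      have "\<exists>\<F>. finite \<F> \<and> \<F> \<subseteq> U ` K \<and> K \<subseteq> \<Union>\<F>"
      proof (rule K[unfolded compactin_def, THEN conjunct2, rule_format], intro conjI ballI)
        show "openin (dual_topology G PT) W" if "W \<in> U ` K" for W using that U(1) by auto
        show "K \<subseteq> \<Union> (U ` K)" using U(2) by auto
      qed
      then obtain \<F> where \<F>: "finite \<F>" "\<F> \<subseteq> U ` K" "K \<subseteq> \<Union>\<F>" by (elim exE conjE)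
      obtain F where F: "finite F" "F \<subseteq> K" "K \<subseteq> \<Union> (U ` F)"
        using finite_subset_image[OF \<F>(1,2)] \<F>(3) by auto
      have "I \<subseteq> (\<Union>\<psi>\<in>F. {b \<in> I. p b \<in> U \<psi>})"
      proof
        fix b assume b: "b \<in> I"
        have "p b \<in> \<Union> (U ` F)" using pK F(3) by blast
        then show "b \<in> (\<Union>\<psi>\<in>F. {b \<in> I. p b \<in> U \<psi>})" using b by simp
      qed
      moreover have "countable (\<Union>\<psi>\<in>F. {b \<in> I. p b \<in> U \<psi>})"
        using F(2) U(3) by (intro countable_UN[OF countable_finite[OF F(1)]]) auto
      ultimately show False using I countable_subset by blast
    qed
    then show thesis using that by blast
  qed
  have \<psi>_hom: "\<psi> \<in> hom G circle_group" using P_characterD(1) KP \<psi> by blast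
  define Binf where "Binf = (\<Inter>b\<in>I. B b)"
  have I0: "I \<noteq> {}" using I by auto
  have Binf_closed: "closedin T Binf" unfolding Binf_def using B_closed I0 by (intro closedin_INT) auto
  have BG: "B b \<subseteq> carrier G" for b by (auto simp: B_def)
  have BinfG: "Binf \<subseteq> carrier G" using I0 BG by (auto simp: Binf_def)
  have \<psi>_Binf: "\<psi> x = 1" if x: "x \<in> Binf" for x
  proof (rule ccontr)
    assume "\<psi> x \<noteq> 1"
    \<comment> \<open>The radius is the distance from \<open>\<psi> x\<close> to 1, so
      \<open>?U\<close> excludes every character with value 1 at \<open>x\<close>; but every
      \<open>p b\<close> with \<open>b \<in> I\<close> has that value on
      \<open>Binf\<close>.\<close>
    let ?U = "{\<phi> \<in> P_characters. dist (\<phi> x) (\<psi> x) < dist 1 (\<psi> x)}"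
    have "openin (dual_topology G PT) ?U"
      using x BinfG by (intro openin_dual_topology_eval) (auto simp: topspace_eq_carrier)
    moreover have "\<psi> \<in> ?U" using \<psi> KP \<open>\<psi> x \<noteq> 1\<close> by auto
    ultimately have "\<not> countable {b \<in> I. p b \<in> ?U}" by (rule accum)
    then have "{b \<in> I. p b \<in> ?U} \<noteq> {}" by (metis countable_empty)
    then obtain b where b: "b \<in> I" "p b \<in> ?U" by blast
    obtain a where a: "a \<in> I" "(b, a) \<in> R" using upper[of "{b}"] b(1) by auto
    then have "x \<in> B' b" using x B_mono[OF a(2)] by (auto simp: Binf_def)
    then show False using b(2) triv by simp
  qed
  \<comment> \<open>Since \<open>\<psi>\<close> is trivial on \<open>Binf\<close> and on
    \<open>M \<psi>\<close>, it is enough to place some \<open>B a\<close> inside their product.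
    Each \<open>V n\<close> gives an index, and countably many indices have an upper bound in
    \<open>I\<close>.\<close>
  have "\<exists>a\<in>I. \<forall>y\<in>B a. \<psi> y = 1"
  proof -
    obtain V where V: "neighbourhood_chain V" "M \<psi> = (\<Inter>n. V n)"
      using M(1)[OF \<psi>] gdelta_subgroup_def by blast
    have "\<exists>a\<in>I. \<forall>y\<in>B a. \<exists>v\<in>Binf. y \<otimes> inv v \<in> V n" for n
    proof (rule ccontr)
      assume neg: "\<not> ?thesis"
      \<comment> \<open>\<open>W\<close> is the product of \<open>Binf\<close> and
        \<open>V n\<close>, an open set containing \<open>Binf\<close>. If no \<open>B a\<close>
        were inside it, the closed sets \<open>B a - W\<close> would share a point, which lies in
        \<open>Binf\<close> and so in \<open>W\<close>.\<close>
      define W where "W = (\<Union>v\<in>Binf. {y \<in> topspace T. inv v \<otimes> y \<in> V n})"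
      have "openin T W"
        unfolding W_def using BinfG neighbourhood_chainD(1)[OF V(1)]
        by (intro openin_Union ballI openin_clauses(3)) (auto intro!: openin_continuous_map_preimage continuous_map_translation)
      have "(\<Inter>a\<in>I. B a - W) \<noteq> {}"
      proof (rule compact_space_closed_chain[OF cpt I0])
        show "closedin T (B a - W)" for a
          using B_closed \<open>openin T W\<close> by (rule closedin_diff)
        show "B a - W \<noteq> {}" if aI: "a \<in> I" for a
        proof -
          obtain y where y: "y \<in> B a" "\<And>v. v \<in> Binf \<Longrightarrow> y \<otimes> inv v \<notin> V n" using neg aI by meson
          have "y \<notin> W"
          proof
            assume "y \<in> W"
            then obtain v where v: "v \<in> Binf" "inv v \<otimes> y \<in> V n" by (auto simp: W_def)
            have "inv v \<otimes> y = y \<otimes> inv v" using v(1) y(1) BinfG BG by (intro m_comm) auto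
            then show False using v y(2) by simp
          qed
          then show ?thesis using y(1) by blast
        qed
        show "B i - W \<subseteq> B j - W \<or> B j - W \<subseteq> B i - W" if "i \<in> I" "j \<in> I" for i j
        proof (cases "i = j")
          case False
          then have "(i, j) \<in> R \<or> (j, i) \<in> R" using total that by simp
          then show ?thesis using B_mono B'_le by (meson Diff_mono order.refl order.trans)
        qed simp
      qed
      then obtain y where y: "\<And>a. a \<in> I \<Longrightarrow> y \<in> B a - W" by blast
      then have yB: "y \<in> Binf" by (auto simp: Binf_def)
      then have "y \<in> W"
        using BinfG neighbourhood_chainD(2)[OF V(1)] by (auto simp: W_def topspace_eq_carrier intro!: bexI[of _ y])
      then show False using y I0 by blast
    qed
    then obtain a where a: "\<And>n. a n \<in> I" "\<And>n y. y \<in> B (a n) \<Longrightarrow> \<exists>v\<in>Binf. y \<otimes> inv v \<in> V n"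
      by metis
    obtain a0 where a0: "a0 \<in> I" "\<And>n. (a n, a0) \<in> R"
      using upper[of "range a"] a(1) by auto
    have "\<psi> y = 1" if y: "y \<in> B a0" for y
    proof -
      have yG: "y \<in> carrier G" using y BG by blast
      have "y \<in> B (a n)" for n using y B_mono[OF a0(2)] B'_le by blast
      then have "\<exists>v\<in>Binf. y \<otimes> inv v \<in> V n" for n by (rule a(2))
      then obtain v where v: "v \<in> Binf" "y \<otimes> inv v \<in> M \<psi>"
        using neighbourhood_chain_closure_mult[OF cpt V(1) Binf_closed yG] V(2) by blast
      have vG: "v \<in> carrier G" using v(1) BinfG by blast
      have "\<psi> (y \<otimes> inv v) = 1" by (rule M(2)[OF \<psi> v(2)])
      then show ?thesis
        using character_mult[OF \<psi>_hom yG] character_inv[OF \<psi>_hom vG] \<psi>_Binf[OF v(1)] vG by simp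
    qed
    then show ?thesis using a0(1) by blast
  qed
  then obtain a where a: "a \<in> I" "\<And>y. y \<in> B a \<Longrightarrow> \<psi> y = 1" by blast
  define J where "J = {b \<in> I. (b, a) \<notin> R}"
  have JB: "B b \<subseteq> B a" if "b \<in> J" for b
  proof (cases "a = b")
    case False
    then have "(a, b) \<in> R" using that a(1) total[of a b] by (simp add: J_def)
    then show ?thesis using B_mono B'_le by blast
  qed simp
  \<comment> \<open>The conditions describe the cosets of \<open>B' c\<close> through
    \<open>q c\<close>; coherence makes them decrease along the order, and compactness gives a
    common point. It serves both at every stage of the next recursion and at its end.\<close>
  have glue: "\<exists>s\<in>B a. \<forall>c\<in>C. inv (q c) \<otimes> s \<in> B' c"
    if C: "C \<subseteq> J" and q: "\<And>c. c \<in> C \<Longrightarrow> q c \<in> B a"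
      and coherent: "\<And>c d. c \<in> C \<Longrightarrow> d \<in> C \<Longrightarrow> (d, c) \<in> R \<Longrightarrow> inv (q d) \<otimes> q c \<in> B' d" for C q
  proof (cases "C = {}")
    case True
    then show ?thesis using subgroup.one_closed[OF B_sub] by blast
  next
    case False
    define S where "S c = {x \<in> carrier G. inv (q c) \<otimes> x \<in> B' c}" for c
    have qG: "q c \<in> carrier G" if "c \<in> C" for c using q[OF that] BG by blast
    have S_mono: "S c \<subseteq> S d" if cd: "c \<in> C" "d \<in> C" "(d, c) \<in> R" for c d
    proof
      fix x assume x: "x \<in> S c"
      then have xG: "x \<in> carrier G" by (simp add: S_def)
      have "inv (q c) \<otimes> x \<in> B' d" using x B'_le B_mono[OF cd(3)] by (auto simp: S_def)
      then have "(inv (q d) \<otimes> q c) \<otimes> (inv (q c) \<otimes> x) \<in> B' d"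
        by (rule subgroup.m_closed[OF B'_sub coherent[OF cd]])
      also have "(inv (q d) \<otimes> q c) \<otimes> (inv (q c) \<otimes> x) = inv (q d) \<otimes> x"
        using qG[OF cd(1)] qG[OF cd(2)] xG by (simp add: m_assoc) (simp add: m_assoc[symmetric])
      finally show "x \<in> S d" using xG by (simp add: S_def)
    qed
    have "(\<Inter>c\<in>C. S c) \<noteq> {}"
    proof (rule compact_space_closed_chain[OF cpt False])
      show "closedin T (S c)" if "c \<in> C" for c
        unfolding S_def using qG[OF that] by (intro closedin_translate B'_closed) simp
      show "S c \<noteq> {}" if "c \<in> C" for c
        using qG[OF that] subgroup.one_closed[OF B'_sub, of c] by (auto simp: S_def intro!: exI[of _ "q c"])
      show "S c \<subseteq> S d \<or> S d \<subseteq> S c" if cd: "c \<in> C" "d \<in> C" for c d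
      proof (cases "c = d")
        case False
        moreover have "c \<in> I" "d \<in> I" using cd C by (auto simp: J_def)
        ultimately have "(c, d) \<in> R \<or> (d, c) \<in> R" using total by simp
        then show ?thesis using S_mono cd by blast
      qed simp
    qed
    then obtain s where s: "\<And>c. c \<in> C \<Longrightarrow> s \<in> S c" by blast
    obtain c where c: "c \<in> C" using False by blast
    have sG: "s \<in> carrier G" and "inv (q c) \<otimes> s \<in> B' c" using s[OF c] by (simp_all add: S_def)
    then have "inv (q c) \<otimes> s \<in> B a" using JB B'_le c C by blast
    then have "q c \<otimes> (inv (q c) \<otimes> s) \<in> B a" by (rule subgroup.m_closed[OF B_sub q[OF c]])
    moreover have "q c \<otimes> (inv (q c) \<otimes> s) = s" using qG[OF c] sG by (simp add: m_assoc[symmetric])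
    ultimately have "s \<in> B a" by simp
    then show ?thesis using s by (auto simp: S_def)
  qed
  \<comment> \<open>Later choices stay in the coset of \<open>B' b\<close> through
    \<open>q b\<close>, on which \<open>p b\<close> is constant; so a value far from 1, once
    reached, is preserved.\<close>
  have "\<exists>q. \<forall>b. b \<in> J \<longrightarrow> q b \<in> B a \<and> (\<forall>c\<in>J. (c, b) \<in> R \<longrightarrow> inv (q c) \<otimes> q b \<in> B' c) \<and> 1/2 \<le> dist (p b (q b)) 1"
  proof (rule dependent_wf_choice[OF R(1)])
    fix q b assume q: "\<And>c. (c, b) \<in> R \<Longrightarrow> c \<in> J \<longrightarrow> q c \<in> B a \<and>
      (\<forall>d\<in>J. (d, c) \<in> R \<longrightarrow> inv (q d) \<otimes> q c \<in> B' d) \<and> 1/2 \<le> dist (p c (q c)) 1"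
    show "\<exists>t. b \<in> J \<longrightarrow> t \<in> B a \<and> (\<forall>c\<in>J. (c, b) \<in> R \<longrightarrow> inv (q c) \<otimes> t \<in> B' c) \<and> 1/2 \<le> dist (p b t) 1"
    proof (cases "b \<in> J")
      case True
      have "\<exists>s\<in>B a. \<forall>c\<in>{c \<in> J. (c, b) \<in> R}. inv (q c) \<otimes> s \<in> B' c"
        using q by (intro glue) auto
      then obtain s where s: "s \<in> B a" "\<And>c. c \<in> J \<Longrightarrow> (c, b) \<in> R \<Longrightarrow> inv (q c) \<otimes> s \<in> B' c" by blast
      obtain x where x: "x \<in> B b" "p b x \<noteq> 1" using p[of b] by (auto simp: B_def)
      obtain n where n: "n \<in> B b" "1 \<le> dist (p b n) 1"
        using character_far_from_one[OF p_hom B_sub x] by blast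
      have sG: "s \<in> carrier G" and nG: "n \<in> carrier G" using s(1) n(1) BG by blast+
      show ?thesis
      proof (cases "1/2 \<le> dist (p b s) 1")
        case True
        then show ?thesis using s by blast
      next
        case False
        \<comment> \<open>Here \<open>s\<close> is closer than 1/2 to failure while \<open>n\<close>
          moves the value by at least 1, so their product is at least 1/2 away. As
          \<open>n \<in> B b\<close>, the corrected point stays in all earlier cosets.\<close>
        have "p b (s \<otimes> n) - 1 = p b s * (p b n - 1) + (p b s - 1)"
          using character_mult[OF p_hom sG nG] by (simp add: algebra_simps)
        then have "cmod (p b s * (p b n - 1)) \<le> dist (p b (s \<otimes> n)) 1 + dist (p b s) 1"
          by (metis add_diff_cancel_right' dist_norm norm_triangle_ineq4)
        then have "1/2 \<le> dist (p b (s \<otimes> n)) 1"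
          using False n(2) character_norm[OF p_hom sG] by (simp add: norm_mult dist_norm)
        moreover have "s \<otimes> n \<in> B a"
          using JB[OF True] n(1) by (intro subgroup.m_closed[OF B_sub s(1)]) blast
        moreover have "inv (q c) \<otimes> (s \<otimes> n) \<in> B' c" if c: "c \<in> J" "(c, b) \<in> R" for c
        proof -
          have "(inv (q c) \<otimes> s) \<otimes> n \<in> B' c"
            using B_mono[OF c(2)] n(1) by (intro subgroup.m_closed[OF B'_sub s(2)[OF c]]) blast
          moreover have "q c \<in> carrier G" using q[OF c(2)] c(1) BG by blast
          ultimately show ?thesis using sG nG by (simp add: m_assoc)
        qed
        ultimately show ?thesis by blast
      qed
    qed simp
  qed simp
  then obtain q where q: "\<And>b. b \<in> J \<Longrightarrow> q b \<in> B a" "\<And>b. b \<in> J \<Longrightarrow> 1/2 \<le> dist (p b (q b)) 1"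
    "\<And>b c. b \<in> J \<Longrightarrow> c \<in> J \<Longrightarrow> (c, b) \<in> R \<Longrightarrow> inv (q c) \<otimes> q b \<in> B' c"
    by metis
  have "\<exists>h\<in>B a. \<forall>c\<in>J. inv (q c) \<otimes> h \<in> B' c"
    by (rule glue) (use q in auto)
  then obtain h where h: "h \<in> B a" "\<And>c. c \<in> J \<Longrightarrow> inv (q c) \<otimes> h \<in> B' c" by blast
  have hG: "h \<in> carrier G" using h(1) BG by blast
  have far: "1/2 \<le> dist (p b h) 1" if b: "b \<in> J" for b
  proof -
    have qG: "q b \<in> carrier G" using q(1)[OF b] BG by blast
    have "p b (inv (q b) \<otimes> h) = 1" by (rule triv[OF h(2)[OF b]])
    then have "inverse (p b (q b)) * p b h = 1"
      using character_mult[OF p_hom, of "inv (q b)" h] character_inv[OF p_hom qG] qG hG by simp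
    moreover have "p b (q b) \<noteq> 0" using character_norm[OF p_hom qG, of b] by auto
    ultimately have "p b h = p b (q b)" by (simp add: field_simps)
    then show ?thesis using q(2)[OF b] by simp
  qed
  \<comment> \<open>This neighbourhood of \<open>\<psi>\<close> can contain \<open>p b\<close> only
    for indices \<open>b\<close> below \<open>a\<close>, which are countable in number.\<close>
  let ?U = "{\<phi> \<in> P_characters. dist (\<phi> h) 1 < 1/2}"
  have "openin (dual_topology G PT) ?U"
    using hG by (intro openin_dual_topology_eval) (simp add: topspace_eq_carrier)
  moreover have "\<psi> \<in> ?U" using \<psi> KP a(2)[OF h(1)] by auto
  ultimately have "\<not> countable {b \<in> I. p b \<in> ?U}" by (rule accum)
  moreover have "{b \<in> I. p b \<in> ?U} \<subseteq> {b. (b, a) \<in> R}"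
    using far by (force simp: J_def)
  ultimately show False using below[of a] countable_subset by blast
qed

section \<open>Reflexivity\<close>

lemma P_character_separates:
  assumes N: "gdelta_subgroup N" and x: "x \<in> carrier G" "x \<notin> N"
  obtains \<phi> where "\<phi> \<in> P_characters" "\<And>y. y \<in> N \<Longrightarrow> \<phi> y = 1" "\<phi> x \<noteq> 1"
proof -
  obtain f where f: "f \<in> hom G circle_group" "\<And>y. y \<in> N \<Longrightarrow> f y = 1" "f x \<noteq> 1"
    using character_separates_subgroup[OF gdelta_subgroup_imp_subgroup[OF N] x] by metis
  show thesis
  proof (rule that)
    show "restrict f (carrier G) \<in> P_characters" by (rule P_characterI_restrict[OF f(1) N f(2)])
    show "restrict f (carrier G) y = 1" if "y \<in> N" for y
      using that f(2) gdelta_subgroup_mem(2)[OF N that] by simp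
    show "restrict f (carrier G) x \<noteq> 1" using f(3) x(1) by simp
  qed
qed

lemma P_character_divide:
  assumes "\<phi> \<in> P_characters" "a \<in> carrier G" "b \<in> carrier G"
  shows "\<phi> (a \<otimes> inv b) * \<phi> b = \<phi> a"
  using character_mult[OF P_characterD(1)[OF assms(1)], of "a \<otimes> inv b" b] assms(2,3)
  by (simp add: m_assoc)

section \<open>The evaluation map\<close>

abbreviation ev :: "'a \<Rightarrow> ('a \<Rightarrow> complex) \<Rightarrow> complex" where
  "ev \<equiv> evaluation_map G PT"

lemma ev_apply: "a \<in> carrier G \<Longrightarrow> ev a = (\<lambda>\<phi>\<in>P_characters. \<phi> a)"
  by (simp add: evaluation_map_def)

lemma ev_in_bidual:
  assumes a: "a \<in> carrier G"
  shows "ev a \<in> continuous_characters (dual_group G PT) (dual_topology G PT)"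
proof -
  have "ev a \<in> hom (dual_group G PT) circle_group"
    using evaluation_hom_circle[OF a] P_character_mult by (simp add: ev_apply[OF a] hom_def Pi_def)
  moreover have "continuous_map (dual_topology G PT) circle_topology (ev a)"
    unfolding continuous_map_def
  proof (intro conjI allI impI)
    show "ev a \<in> topspace (dual_topology G PT) \<rightarrow> topspace circle_topology"
      using character_norm[OF P_characterD(1) a] by (simp add: ev_apply[OF a])
    fix U assume "openin circle_topology U"
    then obtain V where V: "open V" "U = sphere 0 1 \<inter> V"
      by (auto simp: circle_topology_def openin_open)
    show "openin (dual_topology G PT) {\<phi> \<in> topspace (dual_topology G PT). ev a \<phi> \<in> U}"
    proof (subst openin_subopen, intro ballI)
      fix \<phi> assume "\<phi> \<in> {\<phi> \<in> topspace (dual_topology G PT). ev a \<phi> \<in> U}"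
      then have \<phi>: "\<phi> \<in> P_characters" "\<phi> a \<in> V" using V(2) by (auto simp: ev_apply[OF a])
      then obtain \<epsilon> where \<epsilon>: "0 < \<epsilon>" "\<And>z. dist z (\<phi> a) < \<epsilon> \<Longrightarrow> z \<in> V"
        using V(1) unfolding open_dist by blast
      have "openin (dual_topology G PT) {\<psi> \<in> P_characters. dist (\<psi> a) (\<phi> a) < \<epsilon>}"
        using a by (intro openin_dual_topology_eval) (simp add: topspace_eq_carrier)
      moreover have "{\<psi> \<in> P_characters. dist (\<psi> a) (\<phi> a) < \<epsilon>} \<subseteq>
          {\<phi> \<in> topspace (dual_topology G PT). ev a \<phi> \<in> U}"
        using \<epsilon>(2) character_norm[OF P_characterD(1) a] by (auto simp: ev_apply[OF a] V(2))
      ultimately show "\<exists>W. openin (dual_topology G PT) W \<and> \<phi> \<in> W \<and>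
          W \<subseteq> {\<phi> \<in> topspace (dual_topology G PT). ev a \<phi> \<in> U}"
        using \<phi>(1) \<epsilon>(1) by (intro exI[of _ "{\<psi> \<in> P_characters. dist (\<psi> a) (\<phi> a) < \<epsilon>}"]) simp
    qed
  qed
  ultimately show ?thesis
    using a by (simp add: continuous_characters_def[of "dual_group G PT"] ev_apply)
qed

text \<open>Compact subsets of \<open>PT\<close> are finite, so continuity of \<open>\<xi>\<close>
  at the trivial character is exactly the finite-coordinate condition required by the pairing
  lemma.\<close>

lemma ev_surj:
  assumes \<xi>: "\<xi> \<in> continuous_characters (dual_group G PT) (dual_topology G PT)"
  obtains a where "a \<in> carrier G" "\<xi> = ev a"
proof -
  have hom: "\<xi> \<in> hom (dual_group G PT) circle_group"
    and cont: "continuous_map (dual_topology G PT) circle_topology \<xi>"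
    and ext: "\<xi> \<in> extensional P_characters"
    using \<xi> by (simp_all add: continuous_characters_def[of "dual_group G PT"])
  interpret D: group "dual_group G PT" by (rule group_dual_P)
  have near: "\<exists>F \<delta>. finite F \<and> F \<subseteq> carrier G \<and> 0 < \<delta> \<and>
      (\<forall>\<phi>\<in>carrier (dual_group G PT). (\<forall>a\<in>F. dist (\<phi> a) 1 < \<delta>) \<longrightarrow> dist (\<xi> \<phi>) 1 < \<epsilon>)"
    if \<epsilon>: "0 < \<epsilon>" for \<epsilon>
  proof -
    let ?U = "{\<phi> \<in> topspace (dual_topology G PT). \<xi> \<phi> \<in> sphere 0 1 \<inter> ball 1 \<epsilon>}"
    have "openin (dual_topology G PT) ?U"
      by (rule openin_continuous_map_preimage[OF cont]) (simp add: circle_topology_def openin_open_Int)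
    then have "dual_open G PT ?U" by (simp only: openin_dual_topology)
    moreover have "\<one>\<^bsub>dual_group G PT\<^esub> \<in> ?U"
      using D.character_one[OF hom] D.one_closed \<epsilon> by simp
    ultimately obtain K \<delta> where K: "compactin PT K" "\<delta> > 0"
      "{\<psi> \<in> P_characters. \<forall>x\<in>K. dist (\<psi> x) (\<one>\<^bsub>dual_group G PT\<^esub> x) < \<delta>} \<subseteq> ?U"
      unfolding dual_open_def by blast
    have KG: "K \<subseteq> carrier G" using compactin_subset_topspace[OF K(1)] by (simp add: topspace_eq_carrier)
    have "dist (\<xi> \<phi>) 1 < \<epsilon>" if "\<phi> \<in> P_characters" "\<forall>a\<in>K. dist (\<phi> a) 1 < \<delta>" for \<phi>
    proof -
      have "\<phi> \<in> {\<psi> \<in> P_characters. \<forall>x\<in>K. dist (\<psi> x) (\<one>\<^bsub>dual_group G PT\<^esub> x) < \<delta>}"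
        using that KG by (auto simp: subset_iff)
      then have "\<phi> \<in> ?U" using K(3) by blast
      then show ?thesis by (simp add: dist_commute)
    qed
    then show ?thesis
      using K(2) KG compactin_P_modification_imp_finite[OF Hausdorff K(1)]
      by (intro exI[of _ K] exI[of _ \<delta>]) simp
  qed
  have right: "(\<lambda>a. \<phi> a) \<in> hom G circle_group" if "\<phi> \<in> carrier (dual_group G PT)" for \<phi>
    using that P_characterD(1) by simp
  obtain a where a: "a \<in> carrier G" "\<And>\<phi>. \<phi> \<in> carrier (dual_group G PT) \<Longrightarrow> \<xi> \<phi> = \<phi> a"
    using character_eq_pairing[of G "dual_group G PT" "\<lambda>a \<phi>. \<phi> a", OF is_group D.is_group
        evaluation_hom_circle right hom near] by metis
  have "\<xi> = ev a"
    unfolding ev_apply[OF a(1)]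
    using extensional_restrict[OF ext] a(2) by (metis (no_types, lifting) dual_group_simps(1) restrict_ext)
  then show thesis using a(1) that by blast
qed

text \<open>As points are closed, some G_delta subgroup misses the quotient of two distinct points,
  and a character separates the quotient from that subgroup.\<close>

lemma ev_inj: "inj_on ev (carrier G)"
proof (rule inj_onI, rule ccontr)
  fix a b assume a: "a \<in> carrier G" and b: "b \<in> carrier G" and eq: "ev a = ev b" and ne: "a \<noteq> b"
  let ?x = "a \<otimes> inv b"
  have x: "?x \<in> carrier G" "?x \<noteq> \<one>"
  proof -
    show "?x \<in> carrier G" using a b by simp
    show "?x \<noteq> \<one>"
    proof
      assume "?x = \<one>"
      then have "?x \<otimes> b = b" using b by simp
      then show False using a b ne by (simp add: m_assoc)
    qed
  qed
  have "openin PT (topspace T - {?x})"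
    using x(1) Hausdorff
    by (intro openin_imp_openin_P_modification openin_diff openin_topspace closedin_Hausdorff_singleton)
      (simp_all add: topspace_eq_carrier)
  moreover have "\<one> \<in> topspace T - {?x}" using x(2) by (simp add: topspace_eq_carrier)
  ultimately obtain N where N: "gdelta_subgroup N" "N \<subseteq> topspace T - {?x}"
    by (rule gdelta_subgroup_subset)
  then have "?x \<notin> N" by blast
  then obtain \<phi> where \<phi>: "\<phi> \<in> P_characters" "\<phi> ?x \<noteq> 1"
    using P_character_separates[OF N(1) x(1)] by metis
  have "\<phi> a = \<phi> b" using fun_cong[OF eq, of \<phi>] \<phi>(1) by (simp add: ev_apply a b)
  then have "\<phi> ?x * \<phi> b = \<phi> b" using P_character_divide[OF \<phi>(1) a b] by simp
  moreover have "\<phi> b \<noteq> 0" using character_norm[OF P_characterD(1)[OF \<phi>(1)] b] by auto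
  ultimately show False using \<phi>(2) by simp
qed

text \<open>With one \<open>N\<close> annihilated by all of \<open>K\<close>, the evaluations at
  points of a coset of \<open>N\<close> coincide on \<open>K\<close>, not merely up to
  \<open>\<epsilon>\<close>.\<close>

lemma ev_continuous:
  assumes "compact_space T"
  shows "continuous_map PT (bidual_topology G PT) ev"
  unfolding continuous_map_def
proof (intro conjI allI impI)
  show "ev \<in> topspace PT \<rightarrow> topspace (bidual_topology G PT)"
    using ev_in_bidual by (simp add: topspace_eq_carrier)
  fix U assume U: "openin (bidual_topology G PT) U"
  show "openin PT {x \<in> topspace PT. ev x \<in> U}"
    unfolding openin_P_modification_group topspace_PT
  proof (intro conjI ballI)
    fix x assume "x \<in> {x \<in> carrier G. ev x \<in> U}"
    then have x: "x \<in> carrier G" "ev x \<in> U" by auto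
    obtain K \<epsilon> where K: "compactin (dual_topology G PT) K" "\<epsilon> > 0"
      "{\<psi> \<in> continuous_characters (dual_group G PT) (dual_topology G PT).
          \<forall>\<phi>\<in>K. dist (\<psi> \<phi>) (ev x \<phi>) < \<epsilon>} \<subseteq> U"
      using U x(2) unfolding openin_dual_topology[of "dual_group G PT"] dual_open_def by blast
    obtain N where N: "gdelta_subgroup N" "\<forall>\<phi>\<in>K. \<forall>n\<in>N. \<phi> n = 1"
      using compactin_dual_trivial[OF assms K(1)] by blast
    have KP: "K \<subseteq> P_characters" using compactin_subset_topspace[OF K(1)] by simp
    have "x \<otimes> n \<in> {x \<in> carrier G. ev x \<in> U}" if n: "n \<in> N" for n
    proof -
      have nG: "n \<in> carrier G" using gdelta_subgroup_mem(2)[OF N(1) n] .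
      have "ev (x \<otimes> n) \<phi> = ev x \<phi>" if "\<phi> \<in> K" for \<phi>
        using that KP N(2) n x(1) nG character_mult[OF P_characterD(1), of \<phi> x n]
        by (auto simp: ev_apply)
      then have "ev (x \<otimes> n) \<in> {\<psi> \<in> continuous_characters (dual_group G PT) (dual_topology G PT).
          \<forall>\<phi>\<in>K. dist (\<psi> \<phi>) (ev x \<phi>) < \<epsilon>}"
        using ev_in_bidual x(1) nG K(2) by simp
      then show ?thesis using K(3) x(1) nG by blast
    qed
    then show "\<exists>N. gdelta_subgroup N \<and> (\<forall>n\<in>N. x \<otimes> n \<in> {x \<in> carrier G. ev x \<in> U})"
      using N(1) by blast
  qed simp
qed

text \<open>The annihilator of \<open>N\<close> with radius 1 is the required neighbourhood: an
  evaluation that close to \<open>ev x\<close> on it must come from the coset of \<open>N\<close>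
  through \<open>x\<close>.\<close>

lemma ev_open: "open_map PT (bidual_topology G PT) ev"
  unfolding open_map_def openin_dual_topology[of "dual_group G PT"] dual_open_def
proof (intro allI impI conjI ballI)
  fix U assume U: "openin PT U"
  then have UG: "U \<subseteq> carrier G" by (simp add: openin_P_modification_group)
  show "ev ` U \<subseteq> continuous_characters (dual_group G PT) (dual_topology G PT)"
    using ev_in_bidual UG by blast
  fix \<eta> assume "\<eta> \<in> ev ` U"
  then obtain x where x: "x \<in> U" "\<eta> = ev x" by blast
  have xG: "x \<in> carrier G" using x(1) UG by blast
  obtain N where N: "gdelta_subgroup N" "\<forall>n\<in>N. x \<otimes> n \<in> U"
    using U x(1) unfolding openin_P_modification_group by blast
  let ?K = "{\<phi> \<in> P_characters. \<forall>x\<in>N. \<phi> x = 1}"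
  have "\<xi> \<in> ev ` U" if \<xi>: "\<xi> \<in> continuous_characters (dual_group G PT) (dual_topology G PT)"
    "\<forall>\<phi>\<in>?K. dist (\<xi> \<phi>) (\<eta> \<phi>) < 1" for \<xi>
  proof -
    obtain a where a: "a \<in> carrier G" "\<xi> = ev a" by (rule ev_surj[OF \<xi>(1)])
    let ?y = "a \<otimes> inv x"
    have yG: "?y \<in> carrier G" using a xG by simp
    have near: "dist (\<phi> ?y) 1 < 1" if \<phi>: "\<phi> \<in> ?K" for \<phi>
    proof -
      have P: "\<phi> \<in> P_characters" using \<phi> by simp
      have n: "cmod (\<phi> x) = 1" by (rule character_norm[OF P_characterD(1)[OF P] xG])
      have "dist (\<phi> a) (\<phi> x) < 1" using \<xi>(2) \<phi> P by (simp add: a x ev_apply xG)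
      also have "dist (\<phi> a) (\<phi> x) = cmod ((\<phi> ?y - 1) * \<phi> x)"
        using P_character_divide[OF P a(1) xG] by (simp add: dist_norm algebra_simps)
      finally show ?thesis using n by (simp add: norm_mult dist_norm)
    qed
    have "?y \<in> N"
    proof (rule ccontr)
      assume "?y \<notin> N"
      then obtain \<phi> where \<phi>: "\<phi> \<in> P_characters" "\<And>z. z \<in> N \<Longrightarrow> \<phi> z = 1" "\<phi> ?y \<noteq> 1"
        using P_character_separates[OF N(1) yG] by metis
      have hom: "\<phi> \<in> hom G circle_group" by (rule P_characterD(1)[OF \<phi>(1)])
      have "dist (\<phi> ?y ^ k) 1 < 1" for k :: nat
      proof -
        \<comment> \<open>The annihilator is closed under powers, so closeness to 1 at
          \<open>?y\<close> holds for all powers of the value \<open>\<phi> ?y\<close> and forces it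
          to be 1.\<close>
        have "restrict (\<lambda>z. \<phi> z ^ k) (carrier G) \<in> P_characters"
        proof (rule P_characterI_restrict[OF _ N(1)])
          show "(\<lambda>z. \<phi> z ^ k) \<in> hom G circle_group"
            using hom by (simp add: hom_def Pi_def norm_power power_mult_distrib)
        qed (simp add: \<phi>(2))
        then have "restrict (\<lambda>z. \<phi> z ^ k) (carrier G) \<in> ?K"
          using \<phi>(2) gdelta_subgroup_mem(2)[OF N(1)] by simp
        from near[OF this] show ?thesis using yG by simp
      qed
      then show False using unit_powers_near_one character_norm[OF hom yG] \<phi>(3) by blast
    qed
    then have "x \<otimes> ?y \<in> U" using N(2) by blast
    moreover have "x \<otimes> ?y = a" using a(1) xG by (simp add: m_lcomm)
    ultimately show ?thesis using a(2) by auto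
  qed
  then show "\<exists>K \<epsilon>. compactin (dual_topology G PT) K \<and> 0 < \<epsilon> \<and>
      {\<psi> \<in> continuous_characters (dual_group G PT) (dual_topology G PT).
         \<forall>\<phi>\<in>K. dist (\<psi> \<phi>) (\<eta> \<phi>) < \<epsilon>} \<subseteq> ev ` U"
    using compactin_annihilator[OF N(1)] by (intro exI[of _ ?K] exI[of _ 1]) auto
qed

end

theorem proposition6p11:
  fixes H :: "('a, 'b) monoid_scheme" and T :: "'a topology"
  assumes "topological_abelian_group H T"
    and "compact_space T"
  shows "reflexive_group H (P_modification T)"
proof -
  interpret topological_abelian_group H T by fact
  have surj: "ev ` carrier H = continuous_characters (dual_group H PT) (dual_topology H PT)"
    using ev_in_bidual ev_surj by (metis (no_types, lifting) image_eqI image_subsetI subsetI subset_antisym)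
  have "ev \<in> hom H (bidual_group H PT)"
  proof (rule homI)
    show "ev a \<in> carrier (bidual_group H PT)" if "a \<in> carrier H" for a
      using ev_in_bidual[OF that] by simp
    show "ev (a \<otimes>\<^bsub>H\<^esub> b) = ev a \<otimes>\<^bsub>bidual_group H PT\<^esub> ev b" if "a \<in> carrier H" "b \<in> carrier H" for a b
      using that character_mult[OF P_characterD(1)] by (auto simp: ev_apply fun_eq_iff)
  qed
  then have "ev \<in> iso H (bidual_group H PT)"
    using surj ev_inj by (simp add: iso_iff)
  moreover have "homeomorphic_map PT (bidual_topology H PT) ev"
    by (rule bijective_open_imp_homeomorphic_map[OF ev_continuous[OF assms(2)] ev_open])
      (simp_all add: topspace_eq_carrier surj ev_inj)
  ultimately show ?thesis
    unfolding reflexive_group_def using topological_abelian_group_P_modification[OF assms(1)] by blast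
qed

end
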